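(* Let $\ell \geq 4$ be a fixed integer. Then for every sufficiently large integer $n$, \[ \left(4^{\ell+1} z_{\ell,\ell} (1+o(1)) \right)^{-1} \leq \mathbf{d}(Q_n, C_{2 \ell}, C_6) \leq 0.36577. \]
   Context: $Q_n$ denotes the $n$-dimensional hypercube: its vertices are the binary vectors of length $n$, two vectors being adjacent iff they differ in exactly one coordinate (the flip coordinate of the edge). $C_m$ is the cycle on $m$ vertices. For graphs $G$ and $T$, a copy of $T$ in $G$ is a subgraph of $G$ isomorphic to $T$, and $N(G,T)$ is the number of copies of $T$ in $G$. A graph is $H$-free if it has no subgraph isomorphic to $H$. For subgraphs $T,H$ of $G$, $\mathrm{ex}(G,T,H)=\max\{N(G',T): G'\subseteq G,\ G' \text{ is } H\text{-free}\}$ and $\mathbf{d}(G,T,H)=\mathrm{ex}(G,T,H)/N(G,T)$. For integers $k,\ell$, $z_{k,\ell}$ denotes the number of copies of $C_{2\ell}$ in $Q_k$ whose edges together use all $k$ coordinates as flip coordinates. The term $o(1)$ denotes a nonnegative quantity tending to $0$ as $n\to\infty$ with $\ell$ fixed. *)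

theory Defs
  imports Complex_Main
begin

text \<open>A simple graph is a pair of a finite vertex set and a set of two-element edges.\<close>

type_synonym 'a graph = "'a set \<times> 'a set set"

abbreviation verts :: "'a graph \<Rightarrow> 'a set" where
  "verts G \<equiv> fst G"

abbreviation edges :: "'a graph \<Rightarrow> 'a set set" where
  "edges G \<equiv> snd G"

definition simple_graph :: "'a graph \<Rightarrow> bool" where
  "simple_graph G \<longleftrightarrow> finite (verts G) \<and> (\<forall>e\<in>edges G. e \<subseteq> verts G \<and> card e = 2)"

definition subgraph :: "'a graph \<Rightarrow> 'a graph \<Rightarrow> bool" where
  "subgraph H G \<longleftrightarrow> simple_graph H \<and> verts H \<subseteq> verts G \<and> edges H \<subseteq> edges G"

definition isomorphic :: "'a graph \<Rightarrow> 'b graph \<Rightarrow> bool" where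
  "isomorphic G H \<longleftrightarrow>
     (\<exists>f. bij_betw f (verts G) (verts H) \<and>
          (\<forall>x\<in>verts G. \<forall>y\<in>verts G. {x, y} \<in> edges G \<longleftrightarrow> {f x, f y} \<in> edges H))"

definition copies :: "'a graph \<Rightarrow> 'b graph \<Rightarrow> 'a graph set" where
  "copies G T = {K. subgraph K G \<and> isomorphic K T}"

definition num_copies :: "'a graph \<Rightarrow> 'b graph \<Rightarrow> nat" where
  "num_copies G T = card (copies G T)"

definition free_of :: "'a graph \<Rightarrow> 'b graph \<Rightarrow> bool" where
  "free_of G H \<longleftrightarrow> \<not> (\<exists>K. subgraph K G \<and> isomorphic K H)"

definition ex_copies :: "'a graph \<Rightarrow> 'b graph \<Rightarrow> 'c graph \<Rightarrow> nat" where
  "ex_copies G T H = Max {num_copies G' T | G'. subgraph G' G \<and> free_of G' H}"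

definition copy_density :: "'a graph \<Rightarrow> 'b graph \<Rightarrow> 'c graph \<Rightarrow> real" where
  "copy_density G T H = real (ex_copies G T H) / real (num_copies G T)"

text \<open>The definition below yields the cycle on \<open>m\<close> vertices for \<open>m \<ge> 3\<close>.\<close>

definition cycle :: "nat \<Rightarrow> nat graph" where
  "cycle m = ({..<m}, {{i, (i + 1) mod m} | i. i < m})"

definition hypercube :: "nat \<Rightarrow> bool list graph" where
  "hypercube n =
     ({x. length x = n},
      {{x, y} | x y. length x = n \<and> length y = n \<and> card {i. i < n \<and> x ! i \<noteq> y ! i} = 1})"

text \<open>The flip coordinate is meaningful only for edges of a hypercube, where it is unique;
  coordinates are numbered from \<open>0\<close>.\<close>

definition flip_coord :: "bool list set \<Rightarrow> nat" where
  "flip_coord e = (THE i. \<exists>x\<in>e. \<exists>y\<in>e. i < length x \<and> x ! i \<noteq> y ! i)"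

definition z :: "nat \<Rightarrow> nat \<Rightarrow> nat" where
  "z k l = card {K \<in> copies (hypercube k) (cycle (2 * l)). flip_coord ` edges K = {..<k}}"

lemma simple_graph_hypercube: "simple_graph (hypercube n)"
proof -
  have "finite {x :: bool list. length x = n}"
    using finite_lists_length_eq[of "UNIV :: bool set" n] by simp
  moreover have "card {x, y} = 2" if "card {i. i < n \<and> x ! i \<noteq> y ! i} = 1" for x y :: "bool list"
    using that by (cases "x = y") auto
  ultimately show ?thesis
    unfolding simple_graph_def hypercube_def by auto
qed

lemma simple_graph_cycle:
  assumes "3 \<le> m"
  shows "simple_graph (cycle m)"
proof -
  have "i \<noteq> (i + 1) mod m" if "i < m" for i
    using that assms by (cases "i + 1 = m") auto
  then show ?thesis
    using assms unfolding simple_graph_def cycle_def by auto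
qed

lemma flip_coord_eq:
  assumes "length x = n" "length y = n" "{i. i < n \<and> x ! i \<noteq> y ! i} = {j}"
  shows "flip_coord {x, y} = j"
proof -
  have *: "i < n \<and> x ! i \<noteq> y ! i \<longleftrightarrow> i = j" for i
    using assms(3) by blast
  have "(\<exists>u\<in>{x, y}. \<exists>v\<in>{x, y}. i < length u \<and> u ! i \<noteq> v ! i) \<longleftrightarrow> i = j" for i
    using *[of i] assms(1,2) by auto
  then show ?thesis
    unfolding flip_coord_def by simp
qed

lemma finite_subgraphs:
  assumes "simple_graph G"
  shows "finite {K. subgraph K G}"
proof (rule finite_subset)
  show "{K. subgraph K G} \<subseteq> Pow (verts G) \<times> Pow (Pow (verts G))"
    using assms unfolding subgraph_def simple_graph_def by fastforce
  show "finite (Pow (verts G) \<times> Pow (Pow (verts G)))"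
    using assms unfolding simple_graph_def by simp
qed

lemma ex_copies_in:
  assumes "simple_graph G" "edges H \<noteq> {}" "simple_graph H"
  shows "ex_copies G T H \<in> {num_copies G' T | G'. subgraph G' G \<and> free_of G' H}"
  unfolding ex_copies_def
proof (rule Max_in)
  show "finite {num_copies G' T | G'. subgraph G' G \<and> free_of G' H}"
    by (rule finite_subset[OF _ finite_imageI[OF finite_subgraphs[OF assms(1)], of "\<lambda>K. num_copies K T"]]) blast
  have "\<not> isomorphic K H" if "subgraph K ({}, {})" for K :: "'a graph"
  proof
    assume "isomorphic K H"
    then have "verts H = {}"
      using that unfolding isomorphic_def subgraph_def by (auto simp: bij_betw_def)
    then show False
      using assms(2,3) unfolding simple_graph_def by fastforce
  qed
  then have "free_of ({} :: 'a set, {}) H" "subgraph ({}, {}) G"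
    unfolding free_of_def subgraph_def simple_graph_def by auto
  then show "{num_copies G' T | G'. subgraph G' G \<and> free_of G' H} \<noteq> {}"
    by blast
qed

end

theory Submission
  imports Defs "HOL-Combinatorics.Transposition"
begin

text \<open>Upper bound. By symmetry every cherry (pair of adjacent edges) of \<open>Q\<^sub>n\<close> lies in the same number of
  \<open>C\<^bsub>2l\<^esub>\<close>s, so the density is at most the proportion of cherries of \<open>Q\<^sub>n\<close> that lie in a \<open>C\<^sub>6\<close>-free
  \<open>G\<close>. Chung's link graph at \<open>v\<close> joins \<open>i\<close> and \<open>j\<close> when the path \<open>v+i, v+i+j, v+j\<close> lies in \<open>G\<close>. It
  is triangle-free, and every coordinate has at most one link neighbour in the neighbourhood of
  \<open>v\<close> in \<open>G\<close>. Mantel's theorem off that neighbourhood gives \<open>E p\<^sup>2 \<le> 1 - 2 E p + O(1/n)\<close> for the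
  relative degrees \<open>p\<close>, and with \<open>p\<^sup>2 \<le> p\<close> the cherry density is at most \<open>1/3 + 2/n\<close>.

  Lower bound. Fix bits \<open>r\<close>, \<open>B\<close>, \<open>C\<close> and keep the edge from \<open>A\<close> to \<open>A + a\<close> if \<open>|A|\<close> has parity \<open>r\<close> and the
  number of \<open>u \<in> A\<close> above \<open>a\<close> has the parity that \<open>C\<close> prescribes at \<open>a\<close>. A hexagon would need three
  coordinates each of which sees the other two alike, which the relation excludes. A cycle
  \<open>T + a\<^sub>i, T + a\<^sub>i + a\<^bsub>i+1\<^esub>\<close> survives for suitable \<open>C\<close> as soon as each \<open>a\<^sub>i\<close> sees its two cyclic
  neighbours alike. If \<open>B\<close> is empty on the \<open>l\<close> coordinates this holds for alternating orders, which
  need \<open>l\<close> even; for odd \<open>l\<close> two elements of \<open>B\<close> repair the parity. Averaging over \<open>r\<close>, \<open>B\<close>, \<open>C\<close> retains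
  at least a proportion \<open>4\<^bsup>-(l+1)\<^esup>\<close> of these cycles, one for each pair \<open>(S, T)\<close>.\<close>

section \<open>Cycles as labelled subgraphs\<close>

text \<open>Turns a labelling into a graph. By \<open>copies_cycle\<close> every copy of a cycle
  arises this way, so copies are handled through labellings instead of abstract
  isomorphisms.\<close>

definition cyc :: "nat \<Rightarrow> (nat \<Rightarrow> 'a) \<Rightarrow> 'a graph" where
  "cyc m g = (g ` {..<m}, (\<lambda>i. {g i, g (Suc i mod m)}) ` {..<m})"

lemma verts_cyc [simp]: "verts (cyc m g) = g ` {..<m}"
  and edges_cyc: "edges (cyc m g) = (\<lambda>i. {g i, g (Suc i mod m)}) ` {..<m}"
  by (simp_all add: cyc_def)

lemma cyc_cong: "(\<And>i. i < m \<Longrightarrow> g i = h i) \<Longrightarrow> cyc m g = cyc m h"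
  unfolding cyc_def by (auto simp: image_iff intro!: image_cong)

lemma isomorphic_cyc:
  assumes "inj_on g {..<m}"
  shows "isomorphic (cyc m g) (cycle m)"
proof -
  let ?f = "inv_into {..<m} g"
  have bij: "bij_betw ?f (verts (cyc m g)) (verts (cycle m))"
    using assms by (simp add: cycle_def inj_on_imp_bij_betw bij_betw_inv_into)
  have "{g a, g b} \<in> edges (cyc m g) \<longleftrightarrow> {a, b} \<in> edges (cycle m)" if ab: "a < m" "b < m" for a b
  proof -
    have "{g a, g b} = {g i, g (Suc i mod m)} \<longleftrightarrow> {a, b} = {i, Suc i mod m}" if i: "i < m" for i
    proof -
      have "inj_on (image g) (Pow {..<m})"
        using assms by (rule inj_on_image_Pow)
      moreover have "{a, b} \<in> Pow {..<m}" "{i, Suc i mod m} \<in> Pow {..<m}"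
        using ab i by auto
      ultimately have "g ` {a, b} = g ` {i, Suc i mod m} \<longleftrightarrow> {a, b} = {i, Suc i mod m}"
        by (rule inj_on_eq_iff)
      then show ?thesis by simp
    qed
    then show ?thesis
      unfolding edges_cyc cycle_def by (auto simp: image_iff)
  qed
  then have "\<forall>x\<in>verts (cyc m g). \<forall>y\<in>verts (cyc m g).
      {x, y} \<in> edges (cyc m g) \<longleftrightarrow> {?f x, ?f y} \<in> edges (cycle m)"
    using assms by (auto simp: inv_into_f_f)
  with bij show ?thesis
    unfolding isomorphic_def by blast
qed

lemma isomorphic_cycleE:
  assumes "simple_graph K" "isomorphic K (cycle m)"
  obtains g where "inj_on g {..<m}" "K = cyc m g"
proof -
  obtain f where f: "bij_betw f (verts K) {..<m}"
    and E: "\<And>x y. x \<in> verts K \<Longrightarrow> y \<in> verts K \<Longrightarrow> {x, y} \<in> edges K \<longleftrightarrow> {f x, f y} \<in> edges (cycle m)"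
    using assms(2) unfolding isomorphic_def cycle_def by auto
  let ?g = "inv_into (verts K) f"
  have g: "bij_betw ?g {..<m} (verts K)"
    using f by (rule bij_betw_inv_into)
  have fg: "f (?g i) = i" if "i < m" for i
    using f that by (simp add: bij_betw_inv_into_right)
  have gf: "?g (f x) = x" if "x \<in> verts K" for x
    using f that by (simp add: bij_betw_inv_into_left)
  have gV: "?g i \<in> verts K" if "i < m" for i
    using g that by (auto simp: bij_betw_def)
  have "edges K = edges (cyc m ?g)"
  proof (rule Set.set_eqI)
    fix e
    show "e \<in> edges K \<longleftrightarrow> e \<in> edges (cyc m ?g)"
    proof
      assume e: "e \<in> edges K"
      then have "card e = 2" "e \<subseteq> verts K"
        using assms(1) unfolding simple_graph_def by auto
      then obtain x y where xy: "e = {x, y}" "x \<in> verts K" "y \<in> verts K"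
        by (auto simp: card_2_iff)
      then have "{f x, f y} \<in> edges (cycle m)"
        using E e by blast
      then obtain i where i: "i < m" "{f x, f y} = {i, Suc i mod m}"
        unfolding cycle_def by auto
      have "?g ` {f x, f y} = ?g ` {i, Suc i mod m}"
        using i by simp
      then have "e = {?g i, ?g (Suc i mod m)}"
        using gf xy by simp
      then show "e \<in> edges (cyc m ?g)"
        unfolding edges_cyc using i(1) by (intro image_eqI[of _ _ i]) auto
    next
      assume "e \<in> edges (cyc m ?g)"
      then obtain i where i: "i < m" "e = {?g i, ?g (Suc i mod m)}"
        unfolding edges_cyc by auto
      then have "Suc i mod m < m" by simp
      moreover have "{i, Suc i mod m} \<in> edges (cycle m)"
        using i unfolding cycle_def by auto
      ultimately show "e \<in> edges K"
        using i E[of "?g i" "?g (Suc i mod m)"] gV fg by simp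
    qed
  qed
  moreover have "verts K = verts (cyc m ?g)"
    using g by (simp add: bij_betw_def)
  ultimately have "K = cyc m ?g"
    by (simp add: prod_eq_iff)
  moreover have "inj_on ?g {..<m}"
    using g by (simp add: bij_betw_def)
  ultimately show thesis
    using that by blast
qed

lemma Suc_mod_neq: "2 \<le> m \<Longrightarrow> i < m \<Longrightarrow> Suc i mod m \<noteq> i"
  by (cases "Suc i = m") auto

definition cycle_in :: "'a graph \<Rightarrow> nat \<Rightarrow> (nat \<Rightarrow> 'a) \<Rightarrow> bool" where
  "cycle_in G m g \<longleftrightarrow> inj_on g {..<m} \<and> (\<forall>i<m. {g i, g (Suc i mod m)} \<in> edges G)"

lemma subgraph_cyc:
  assumes "simple_graph G" "2 \<le> m" "cycle_in G m g"
  shows "subgraph (cyc m g) G"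
proof -
  have 1: "{g i, g (Suc i mod m)} \<in> edges G" if "i < m" for i
    using assms that unfolding cycle_in_def by blast
  then have "g i \<in> verts G" if "i < m" for i
    using assms(1) that unfolding simple_graph_def by blast
  moreover have "card {g i, g (Suc i mod m)} = 2" if "i < m" for i
    using assms(1) 1[OF that] unfolding simple_graph_def by blast
  ultimately show ?thesis
    using 1 assms(2) unfolding subgraph_def simple_graph_def edges_cyc verts_cyc by auto
qed

lemma copies_cycle:
  assumes "simple_graph G" "2 \<le> m"
  shows "copies G (cycle m) = cyc m ` {g. cycle_in G m g}"
proof
  show "copies G (cycle m) \<subseteq> cyc m ` {g. cycle_in G m g}"
  proof
    fix K assume "K \<in> copies G (cycle m)"
    then have K: "simple_graph K" "edges K \<subseteq> edges G" "isomorphic K (cycle m)"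
      unfolding copies_def subgraph_def by auto
    obtain g where g: "inj_on g {..<m}" "K = cyc m g"
      using isomorphic_cycleE[OF K(1,3)] by blast
    then have "cycle_in G m g"
      using K(2) unfolding cycle_in_def g(2) edges_cyc by (auto simp: image_subset_iff)
    with g show "K \<in> cyc m ` {g. cycle_in G m g}" by blast
  qed
  show "cyc m ` {g. cycle_in G m g} \<subseteq> copies G (cycle m)"
    using subgraph_cyc[OF assms] isomorphic_cyc
    unfolding copies_def cycle_in_def by blast
qed

lemma finite_copies: "simple_graph G \<Longrightarrow> finite (copies G T)"
  by (rule finite_subset[OF _ finite_subgraphs]) (auto simp: copies_def)

lemma free_of_cycle:
  assumes "simple_graph G" "2 \<le> m"
  shows "free_of G (cycle m) \<longleftrightarrow> (\<nexists>g. cycle_in G m g)"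
  using copies_cycle[OF assms] unfolding free_of_def copies_def by blast

lemma cycle_in_mono: "cycle_in G m g \<Longrightarrow> edges G \<subseteq> edges H \<Longrightarrow> cycle_in H m g"
  unfolding cycle_in_def by blast

lemma cycle_in_6:
  assumes "distinct [a, b, c, d, e, f]"
    and "{a, b} \<in> edges G" "{b, c} \<in> edges G" "{c, d} \<in> edges G"
        "{d, e} \<in> edges G" "{e, f} \<in> edges G" "{f, a} \<in> edges G"
  shows "cycle_in G 6 ((!) [a, b, c, d, e, f])"
proof -
  have "{..<6::nat} = {0, 1, 2, 3, 4, 5}" by auto
  moreover have "i < 6 \<longleftrightarrow> i \<in> {0, 1, 2, 3, 4, 5}" for i :: nat by auto
  ultimately show ?thesis
    using assms unfolding cycle_in_def by (auto simp: inj_on_def)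
qed

section \<open>Translates of a vertex of the hypercube\<close>

text \<open>Addition of the indicator vector of \<open>A\<close> modulo 2. Seen from
  \<open>v\<close>, vertices become sets of coordinates and adjacency becomes set algebra.\<close>

definition tr :: "bool list \<Rightarrow> nat set \<Rightarrow> bool list" where
  "tr v A = map (\<lambda>k. (v ! k) \<noteq> (k \<in> A)) [0..<length v]"

lemma length_tr [simp]: "length (tr v A) = length v"
  by (simp add: tr_def)

lemma nth_tr [simp]: "k < length v \<Longrightarrow> tr v A ! k \<longleftrightarrow> (v ! k) \<noteq> (k \<in> A)"
  by (simp add: tr_def)

lemma tr_eq_iff:
  assumes "A \<subseteq> {..<length v}" "B \<subseteq> {..<length v}"
  shows "tr v A = tr v B \<longleftrightarrow> A = B"
  using assms by (auto simp: list_eq_iff_nth_eq)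

lemma tr_tr: "tr (tr v A) B = tr v ((A - B) \<union> (B - A))"
  by (auto simp: list_eq_iff_nth_eq)

lemma tr_empty [simp]: "tr v {} = v"
  by (auto simp: list_eq_iff_nth_eq)

lemma tr_insert: "i \<notin> A \<Longrightarrow> tr (tr v A) {i} = tr v (insert i A)"
  by (subst tr_tr) (rule arg_cong[where f = "tr v"], auto)

lemma tr_insert_back: "i \<notin> A \<Longrightarrow> tr (tr v (insert i A)) {i} = tr v A"
  by (subst tr_tr) (rule arg_cong[where f = "tr v"], auto)

lemma tr_singleton_twice [simp]: "tr (tr v {i}) {i} = v"
  using tr_insert_back[of i "{}" v] by simp

lemma ex_tr:
  assumes "length x = length v"
  obtains A where "A \<subseteq> {..<length v}" "x = tr v A"
proof
  show "{k. k < length v \<and> v ! k \<noteq> x ! k} \<subseteq> {..<length v}"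
    by auto
  show "x = tr v {k. k < length v \<and> v ! k \<noteq> x ! k}"
    using assms by (auto intro!: nth_equalityI)
qed

lemma verts_hypercube [simp]: "verts (hypercube n) = {x. length x = n}"
  by (simp add: hypercube_def)

lemma diff_set_tr: "length x = n \<Longrightarrow> {k. k < n \<and> x ! k \<noteq> tr x A ! k} = A \<inter> {..<n}"
  by auto

lemma edges_hypercube: "edges (hypercube n) = {{x, tr x {i}} | x i. length x = n \<and> i < n}"
proof (intro Set.set_eqI iffI)
  fix e assume "e \<in> edges (hypercube n)"
  then obtain x y where xy: "e = {x, y}" "length x = n" "length y = n"
    and c: "card {i. i < n \<and> x ! i \<noteq> y ! i} = 1"
    unfolding hypercube_def by auto
  obtain i where i: "{i. i < n \<and> x ! i \<noteq> y ! i} = {i}"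
    using c by (auto simp: card_1_singleton_iff)
  have "y = tr x {i}"
    using i xy by (auto simp: list_eq_iff_nth_eq)
  moreover have "i < n"
    using i by auto
  ultimately show "e \<in> {{x, tr x {i}} | x i. length x = n \<and> i < n}"
    using xy by blast
next
  fix e assume "e \<in> {{x, tr x {i}} | x i. length x = n \<and> i < n}"
  then obtain x i where e: "e = {x, tr x {i}}" "length x = n" "i < n"
    by blast
  have "card {k. k < n \<and> x ! k \<noteq> tr x {i} ! k} = 1"
    using e diff_set_tr[of x n "{i}"] by simp
  then show "e \<in> edges (hypercube n)"
    unfolding hypercube_def snd_conv using e
    by (intro CollectI exI[of _ x] exI[of _ "tr x {i}"]) simp
qed

lemma hypercube_edge_iff:
  "{x, y} \<in> edges (hypercube n) \<longleftrightarrow> length x = n \<and> (\<exists>i<n. y = tr x {i})"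
proof
  assume "{x, y} \<in> edges (hypercube n)"
  then obtain u i where "{x, y} = {u, tr u {i}}" "length u = n" "i < n"
    unfolding edges_hypercube by blast
  then show "length x = n \<and> (\<exists>i<n. y = tr x {i})"
    by (auto simp: doubleton_eq_iff)
qed (auto simp: edges_hypercube)

lemma flip_coord_tr: "length x = n \<Longrightarrow> i < n \<Longrightarrow> flip_coord {x, tr x {i}} = i"
  by (rule flip_coord_eq[of _ n]) (auto simp: diff_set_tr)

lemma card_verts_hypercube: "card {x :: bool list. length x = n} = 2 ^ n"
  using card_lists_length_eq[of "UNIV :: bool set" n] by simp

section \<open>Chung's bound on cherries\<close>

text \<open>Adjacent vertices have disjoint neighbourhoods, so the degrees of the two ends of an
  edge add up to at most \<open>card U\<close>; this is summed over \<open>A\<close>. Each edge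
  occurs in \<open>A\<close> in both orders, hence the factor 2 instead of the usual 4. Three equal
  vertices in \<open>free\<close> exclude loops.\<close>

lemma mantel:
  assumes U: "finite U" "A \<subseteq> U \<times> U" and sym: "sym A"
    and free: "\<And>i j k. (i, j) \<in> A \<Longrightarrow> (j, k) \<in> A \<Longrightarrow> (i, k) \<notin> A"
  shows "2 * real (card A) \<le> (real (card U))\<^sup>2"
proof (cases "card A = 0")
  case False
  define deg where "deg i = real (card (A `` {i}))" for i
  have finA: "finite A"
    using U finite_subset by blast
  have fin: "finite (A `` {i})" for i
    using finA by auto
  have A: "A = (SIGMA i:U. A `` {i})"
    using U(2) by auto
  have cardA: "real (card A) = (\<Sum>i\<in>U. deg i)"
    unfolding deg_def by (subst A, subst card_SigmaI) (use U fin in auto)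
  have "(\<Sum>p\<in>A. deg (fst p)) = (\<Sum>i\<in>U. (deg i)\<^sup>2)"
  proof -
    have "(\<Sum>p\<in>A. deg (fst p)) = (\<Sum>i\<in>U. \<Sum>j\<in>A `` {i}. deg i)"
      by (subst A, subst sum.Sigma) (use U fin in \<open>auto simp: case_prod_unfold\<close>)
    then show ?thesis
      by (simp add: deg_def power2_eq_square)
  qed
  moreover have "(\<Sum>p\<in>A. deg (snd p)) = (\<Sum>p\<in>A. deg (fst p))"
    by (rule sum.reindex_bij_witness[of _ prod.swap prod.swap]) (use sym in \<open>auto dest: symD\<close>)
  moreover have "(\<Sum>p\<in>A. deg (fst p) + deg (snd p)) \<le> (\<Sum>p\<in>A. real (card U))"
  proof (rule sum_mono)
    fix p assume p: "p \<in> A"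
    obtain i j where ij: "p = (i, j)" by force
    have "A `` {i} \<inter> A `` {j} = {}"
      using free p ij by blast
    then have "card (A `` {i}) + card (A `` {j}) = card (A `` {i} \<union> A `` {j})"
      using fin by (simp add: card_Un_disjoint)
    also have "\<dots> \<le> card U"
      using U by (intro card_mono) auto
    finally show "deg (fst p) + deg (snd p) \<le> real (card U)"
      unfolding deg_def ij by simp
  qed
  ultimately have "2 * (\<Sum>i\<in>U. (deg i)\<^sup>2) \<le> real (card A) * real (card U)"
    by (simp add: sum.distrib)
  moreover have "(\<Sum>i\<in>U. real (card U) * deg i - (real (card U))\<^sup>2 / 4) \<le> (\<Sum>i\<in>U. (deg i)\<^sup>2)"
    \<comment> \<open>AM-GM at the extremal degree \<open>|U|/2\<close> replaces Cauchy-Schwarz\<close>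
  proof (rule sum_mono)
    fix i
    have "0 \<le> (deg i - real (card U) / 2)\<^sup>2" by simp
    then show "real (card U) * deg i - (real (card U))\<^sup>2 / 4 \<le> (deg i)\<^sup>2"
      by (simp add: power2_eq_square algebra_simps)
  qed
  ultimately have "real (card U) * (2 * real (card A)) \<le> real (card U) * (real (card U))\<^sup>2"
    by (simp add: sum_subtractf cardA flip: sum_distrib_left) (simp add: power2_eq_square algebra_simps)
  moreover have "card U \<noteq> 0"
    using U False by auto
  ultimately show ?thesis by simp
qed simp

section \<open>Link graphs of a hexagon-free graph\<close>

definition nbd :: "bool list graph \<Rightarrow> bool list \<Rightarrow> nat set" where
  "nbd G x = {i. i < length x \<and> {x, tr x {i}} \<in> edges G}"

text \<open>Pairs are ordered, so each cherry counts twice; a vertex of \<open>Q_n\<close> has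
  \<open>n * (n - 1)\<close> of them.\<close>

definition cherries :: "bool list graph \<Rightarrow> bool list \<Rightarrow> (nat \<times> nat) set" where
  "cherries G x = {(i, j). i \<in> nbd G x \<and> j \<in> nbd G x \<and> i \<noteq> j}"

definition link :: "bool list graph \<Rightarrow> bool list \<Rightarrow> (nat \<times> nat) set" where
  "link G v = {(i, j). (i, j) \<in> cherries G (tr v {i, j})}"

lemma nbd_subset: "nbd G x \<subseteq> {..<length x}"
  by (auto simp: nbd_def)

lemma finite_nbd [simp]: "finite (nbd G x)"
  by (rule finite_subset[OF nbd_subset]) simp

lemma card_cherries: "card (cherries G x) = card (nbd G x) * card (nbd G x) - card (nbd G x)"
proof -
  have "cherries G x = nbd G x \<times> nbd G x - (\<lambda>i. (i, i)) ` nbd G x"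
    by (auto simp: cherries_def)
  moreover have "card ((\<lambda>i. (i, i)) ` nbd G x) = card (nbd G x)"
    by (rule card_image) (auto simp: inj_on_def)
  ultimately show ?thesis
    by (subst \<open>cherries G x = _\<close>, subst card_Diff_subset) auto
qed

lemma linkD:
  assumes "(i, j) \<in> link G v"
  shows "i < length v" "j < length v" "i \<noteq> j"
    "{tr v {i}, tr v {i, j}} \<in> edges G" "{tr v {i, j}, tr v {j}} \<in> edges G"
proof -
  show 1: "i < length v" "j < length v" "i \<noteq> j"
    using assms by (auto simp: link_def cherries_def nbd_def)
  have "tr (tr v {i, j}) {i} = tr v {j}" "tr (tr v {i, j}) {j} = tr v {i}"
    using tr_insert_back[of i "{j}" v] tr_insert_back[of j "{i}" v] 1 by (auto simp: insert_commute)
  then show "{tr v {i}, tr v {i, j}} \<in> edges G" "{tr v {i, j}, tr v {j}} \<in> edges G"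
    using assms by (auto simp: link_def cherries_def nbd_def insert_commute)
qed

lemma sym_link: "sym (link G v)"
  by (auto simp: sym_def link_def cherries_def insert_commute)

lemma finite_link [simp]: "finite (link G v)"
  by (rule finite_subset[of _ "{..<length v} \<times> {..<length v}"]) (auto dest: linkD)

text \<open>The three linking paths would close up to the hexagon formed by the middle two levels of
  the 3-cube at \<open>v\<close> in directions \<open>i\<close>, \<open>j\<close>,
  \<open>k\<close>.\<close>

lemma link_triangle_free:
  assumes free: "\<nexists>g. cycle_in G 6 g"
    and ij: "(i, j) \<in> link G v" and jk: "(j, k) \<in> link G v"
  shows "(i, k) \<notin> link G v"
proof
  assume ik: "(i, k) \<in> link G v"
  note L = linkD[OF ij] linkD[OF jk] linkD[OF ik]
  have "cycle_in G 6 ((!) [tr v {i}, tr v {i, j}, tr v {j}, tr v {j, k}, tr v {k}, tr v {i, k}])"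
  proof (rule cycle_in_6)
    show "distinct [tr v {i}, tr v {i, j}, tr v {j}, tr v {j, k}, tr v {k}, tr v {i, k}]"
      using L by (auto simp: tr_eq_iff doubleton_eq_iff)
  qed (use L in \<open>simp_all add: insert_commute\<close>)
  with free show False by blast
qed

text \<open>Otherwise the two linking paths meet at \<open>v + k\<close>, and the edges from
  \<open>v\<close> to \<open>v + i\<close> and \<open>v + j\<close> complete them to a hexagon
  through \<open>v\<close>.\<close>

lemma link_nbd_unique:
  assumes free: "\<nexists>g. cycle_in G 6 g"
    and ik: "(i, k) \<in> link G v" and jk: "(j, k) \<in> link G v"
    and N: "i \<in> nbd G v" "j \<in> nbd G v"
  shows "i = j"
proof (rule ccontr)
  assume ij: "i \<noteq> j"
  note L = linkD[OF ik] linkD[OF jk]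
  have "cycle_in G 6 ((!) [tr v {}, tr v {i}, tr v {i, k}, tr v {k}, tr v {j, k}, tr v {j}])"
  proof (rule cycle_in_6)
    show "distinct [tr v {}, tr v {i}, tr v {i, k}, tr v {k}, tr v {j, k}, tr v {j}]"
      using L ij by (auto simp: tr_eq_iff doubleton_eq_iff simp del: tr_empty)
  qed (use L N in \<open>simp_all add: insert_commute nbd_def\<close>)
  with free show False by blast
qed

text \<open>Mantel's theorem bounds the links with both ends outside the neighbourhood. A link with
  one end inside is determined by its other end, so each of the two orders contributes at most
  \<open>n\<close>.\<close>

lemma card_link:
  assumes free: "\<nexists>g. cycle_in G 6 g" and n: "length v = n"
  shows "2 * real (card (link G v)) \<le> (real n - real (card (nbd G v)))\<^sup>2 + 4 * real n"
proof -
  let ?N = "nbd G v" and ?L = "link G v"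
  let ?U = "{..<n} - ?N"
  let ?A = "?L \<inter> ?U \<times> ?U" and ?B = "{p \<in> ?L. fst p \<in> ?N}" and ?C = "{p \<in> ?L. snd p \<in> ?N}"
  have "inj_on snd ?B"
    using link_nbd_unique[OF free] by (auto simp: inj_on_def)
  moreover have "snd ` ?B \<subseteq> {..<n}"
    using n by (auto dest: linkD)
  ultimately have 1: "card ?B \<le> n"
    using card_inj_on_le[of snd ?B "{..<n}"] by simp
  have "inj_on fst ?C"
    using link_nbd_unique[OF free] symD[OF sym_link[of G v]] by (auto simp: inj_on_def) metis
  moreover have "fst ` ?C \<subseteq> {..<n}"
    using n by (auto dest: linkD)
  ultimately have 2: "card ?C \<le> n"
    using card_inj_on_le[of fst ?C "{..<n}"] by simp
  have "sym ?A"
    using sym_link[of G v] by (auto simp: sym_def)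
  then have 0: "2 * real (card ?A) \<le> (real (card ?U))\<^sup>2"
    using link_triangle_free[OF free] by (intro mantel) blast+
  have "?L \<subseteq> {..<n} \<times> {..<n}"
    using n by (auto dest: linkD)
  then have "?L = ?A \<union> (?B \<union> ?C)"
    by fastforce
  then have "card ?L \<le> card ?A + (card ?B + card ?C)"
    by (metis (no_types, lifting) card_Un_le add_left_mono le_trans)
  moreover have "card ?U = n - card ?N" "card ?N \<le> n"
    using nbd_subset[of G v] n card_mono[of "{..<n}" ?N] by (auto simp: card_Diff_subset)
  ultimately show ?thesis
    using 0 1 2 by (simp add: of_nat_diff)
qed

text \<open>A link \<open>(i, j)\<close> at \<open>v\<close> is a cherry centred at the vertex
  opposite to \<open>v\<close> in the square spanned by \<open>i\<close> and \<open>j\<close>;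
  passing to the opposite vertex is an involution.\<close>

lemma sum_link_eq_sum_cherries:
  "(\<Sum>v | length v = n. card (link G v)) = (\<Sum>x | length x = n. card (cherries G x))"
proof -
  let ?V = "{x :: bool list. length x = n}"
  have fin: "finite ?V"
    using finite_lists_length_eq[of "UNIV :: bool set" n] by simp
  have finc: "finite (cherries G x)" for x
    by (rule finite_subset[of _ "nbd G x \<times> nbd G x"]) (auto simp: cherries_def)
  let ?f = "\<lambda>(v, i, j). (tr v {i, j}, i, j)"
  have inv: "tr (tr v A) A = v" for v A
    by (simp add: tr_tr)
  have "bij_betw ?f (Sigma ?V (link G)) (Sigma ?V (cherries G))"
    by (rule bij_betw_byWitness[of _ ?f]) (auto simp: inv link_def)
  then have "card (Sigma ?V (link G)) = card (Sigma ?V (cherries G))"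
    by (rule bij_betw_same_card)
  then show ?thesis
    using fin finc by (simp add: card_SigmaI)
qed

text \<open>Summing \<open>card_link\<close> over all vertices and trading links for cherries leaves
  an inequality between the first and second moments \<open>D\<close> and \<open>Q\<close> of the
  degrees.\<close>

lemma cherries_bound:
  assumes free: "\<nexists>g. cycle_in G 6 g" and n: "n \<ge> 1"
  shows "real (\<Sum>x | length x = n. card (cherries G x))
    \<le> 2 ^ n * (real n * (real n - 1)) * (1 / 3 + 2 / real n)"
proof -
  let ?V = "{x :: bool list. length x = n}"
  define d where "d x = real (card (nbd G x))" for x
  define D where "D = (\<Sum>x\<in>?V. d x)"
  define Q where "Q = (\<Sum>x\<in>?V. (d x)\<^sup>2)"
  define H where "H = real (\<Sum>x\<in>?V. card (cherries G x))"
  have d_le: "d x \<le> real n" if "x \<in> ?V" for x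
    using that nbd_subset[of G x] card_mono[of "{..<n}" "nbd G x"] by (auto simp: d_def)
  have H: "H = Q - D"
  proof -
    have "real (card (cherries G x)) = (d x)\<^sup>2 - d x" for x
      unfolding card_cherries d_def by (simp add: of_nat_diff power2_eq_square)
    then show ?thesis
      by (simp add: H_def Q_def D_def sum_subtractf)
  qed
  have "2 * H \<le> (\<Sum>x\<in>?V. (real n - d x)\<^sup>2 + 4 * real n)"
    unfolding H_def sum_link_eq_sum_cherries[symmetric] d_def of_nat_sum sum_distrib_left
    by (rule sum_mono) (use card_link[OF free] in auto)
  also have "\<dots> = (\<Sum>x\<in>?V. (real n)\<^sup>2 + 4 * real n - 2 * real n * d x + (d x)\<^sup>2)"
    by (rule sum.cong) (auto simp: power2_eq_square algebra_simps)
  also have "\<dots> = 2 ^ n * ((real n)\<^sup>2 + 4 * real n) - 2 * real n * D + Q"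
    by (simp add: sum.distrib sum_subtractf sum_distrib_left card_verts_hypercube D_def Q_def algebra_simps)
  finally have 1: "2 * H \<le> 2 ^ n * ((real n)\<^sup>2 + 4 * real n) - 2 * real n * D + Q" .
  have 2: "Q \<le> real n * D"
    unfolding Q_def D_def sum_distrib_left
    by (rule sum_mono) (use d_le in \<open>auto simp: power2_eq_square d_def intro!: mult_right_mono\<close>)
  have 3: "D \<le> 2 ^ n * real n"
    using sum_mono[of ?V d "\<lambda>_. real n"] d_le by (simp add: D_def card_verts_hypercube)
  \<comment> \<open>Substituting \<open>Q - D\<close> for \<open>H\<close> in 1 and adding 2 twice
    cancels the terms \<open>2 * n * D\<close>. The leftover \<open>2 * D\<close> is absorbed by 3,
    which turns \<open>4 * n\<close> into \<open>6 * n\<close>.\<close>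
  have "3 * Q \<le> 2 ^ n * ((real n)\<^sup>2 + 6 * real n)"
    using 1 2 3 H by (simp add: algebra_simps)
  then have Q: "Q \<le> 2 ^ n * ((real n)\<^sup>2 + 6 * real n) / 3"
    by simp
  \<comment> \<open>Using 2 once more, now as a lower bound on \<open>D\<close>, gives
    \<open>H <= (1 - 1/n) * Q\<close>, so the factor \<open>n * (n - 1)\<close> splits off
    exactly.\<close>
  have "real n * H = real n * Q - real n * D"
    by (simp add: H right_diff_distrib)
  then have "real n * H \<le> (real n - 1) * Q"
    using 2 by (simp add: left_diff_distrib)
  also have "\<dots> \<le> (real n - 1) * (2 ^ n * ((real n)\<^sup>2 + 6 * real n) / 3)"
    using Q n by (intro mult_left_mono) auto
  finally have "real n * H \<le> (real n - 1) * (2 ^ n * ((real n)\<^sup>2 + 6 * real n) / 3)" .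
  then have "H \<le> (real n - 1) * (2 ^ n * ((real n)\<^sup>2 + 6 * real n) / 3) / real n"
    using n by (simp add: field_simps)
  also have "\<dots> = 2 ^ n * (real n * (real n - 1)) * (1 / 3 + 2 / real n)"
    using n by (simp add: field_simps power2_eq_square)
  finally show ?thesis
    unfolding H_def .
qed

section \<open>Symmetry of the hypercube\<close>

definition map_graph :: "('a \<Rightarrow> 'b) \<Rightarrow> 'a graph \<Rightarrow> 'b graph" where
  "map_graph f K = (f ` verts K, image f ` edges K)"

lemma map_graph_cyc: "map_graph f (cyc m g) = cyc m (f \<circ> g)"
  by (simp add: map_graph_def cyc_def image_image)

lemma inj_on_map_graph:
  assumes "inj_on f V"
  shows "inj_on (map_graph f) {K. verts K \<subseteq> V \<and> edges K \<subseteq> Pow V}"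
proof (rule inj_onI)
  fix K L assume KL: "K \<in> {K. verts K \<subseteq> V \<and> edges K \<subseteq> Pow V}"
    "L \<in> {K. verts K \<subseteq> V \<and> edges K \<subseteq> Pow V}" "map_graph f K = map_graph f L"
  have "inj_on (image f) (Pow V)" "inj_on (image (image f)) (Pow (Pow V))"
    using assms by (auto intro!: inj_on_image_Pow)
  then show "K = L"
    using KL unfolding map_graph_def inj_on_def by (auto simp: prod_eq_iff)
qed

lemma cycle_in_length:
  assumes "cycle_in (hypercube n) m g" "i < m"
  shows "length (g i) = n"
  using assms unfolding cycle_in_def hypercube_edge_iff by blast

text \<open>The two directions lead to the successor and to the predecessor \<open>p\<close>. For
  \<open>m >= 3\<close> these are different vertices, hence reached along different
  coordinates.\<close>

lemma card_nbd_cyc: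
  assumes g: "cycle_in (hypercube n) m g" and m: "3 \<le> m" and i: "i < m"
  shows "card (nbd (cyc m g) (g i)) = 2"
proof -
  define p where "p = (if i = 0 then m - 1 else i - 1)"
  have p: "p < m" "Suc p mod m = i" "p \<noteq> Suc i mod m"
    using i m by (auto simp: p_def mod_Suc)
  have pred: "j = p" if "j < m" "Suc j mod m = i" for j
    using that i by (auto simp: p_def mod_Suc split: if_splits)
  have inj: "inj_on g {..<m}" and E: "\<And>i. i < m \<Longrightarrow> {g i, g (Suc i mod m)} \<in> edges (hypercube n)"
    using g by (auto simp: cycle_in_def)
  obtain a where a: "a < n" "g (Suc i mod m) = tr (g i) {a}"
    using E[OF i] unfolding hypercube_edge_iff by blast
  have "{g i, g p} \<in> edges (hypercube n)"
    using E[OF p(1)] p by (simp add: insert_commute)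
  then obtain b where b: "b < n" "g p = tr (g i) {b}"
    unfolding hypercube_edge_iff by blast
  have len: "length (g i) = n"
    using cycle_in_length[OF g i] .
  have "Suc i mod m < m"
    using m by simp
  then have "g p \<noteq> g (Suc i mod m)"
    using p inj by (auto simp: inj_on_def)
  then have ab: "a \<noteq> b"
    using a b by auto
  have "nbd (cyc m g) (g i) = {a, b}"
  proof
    show "{a, b} \<subseteq> nbd (cyc m g) (g i)"
    proof -
      have "{g i, tr (g i) {a}} \<in> edges (cyc m g)"
        unfolding edges_cyc a(2)[symmetric] using i by blast
      moreover have "{g p, g (Suc p mod m)} \<in> edges (cyc m g)"
        unfolding edges_cyc using p(1) by blast
      then have "{g i, tr (g i) {b}} \<in> edges (cyc m g)"
        using p(2) b(2) by (simp add: insert_commute)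
      ultimately show ?thesis
        using a b len by (simp add: nbd_def)
    qed
    show "nbd (cyc m g) (g i) \<subseteq> {a, b}"
    proof
      fix k assume "k \<in> nbd (cyc m g) (g i)"
      then have k: "k < n" "{g i, tr (g i) {k}} \<in> edges (cyc m g)"
        using len by (auto simp: nbd_def)
      then obtain j where j: "j < m" "{g i, tr (g i) {k}} = {g j, g (Suc j mod m)}"
        unfolding edges_cyc by auto
      have "Suc j mod m < m"
        using m by simp
      then consider "i = j" "tr (g i) {k} = g (Suc j mod m)" | "i = Suc j mod m" "tr (g i) {k} = g j"
        using j inj i by (auto simp: doubleton_eq_iff inj_on_def)
      then have "tr (g i) {k} = tr (g i) {a} \<or> tr (g i) {k} = tr (g i) {b}"
        using a b pred j by cases auto
      then show "k \<in> {a, b}"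
        using k a b len by (auto simp: tr_eq_iff)
    qed
  qed
  with ab show ?thesis by simp
qed

lemma sum_cherries_cyc:
  assumes g: "cycle_in (hypercube n) m g" and m: "3 \<le> m"
  shows "(\<Sum>x | length x = n. card (cherries (cyc m g) x)) = 2 * m"
proof -
  have fin: "finite {x :: bool list. length x = n}"
    using finite_lists_length_eq[of "UNIV :: bool set" n] by simp
  have "nbd (cyc m g) x = {}" if "x \<notin> g ` {..<m}" for x
  proof -
    have "x \<notin> e" if "e \<in> edges (cyc m g)" for e
      using that \<open>x \<notin> _\<close> m unfolding edges_cyc by auto
    then show ?thesis by (auto simp: nbd_def)
  qed
  then have "(\<Sum>x | length x = n. card (cherries (cyc m g) x)) = (\<Sum>x\<in>g ` {..<m}. card (cherries (cyc m g) x))"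
    using cycle_in_length[OF g] fin by (intro sum.mono_neutral_right) (auto simp: card_cherries)
  also have "\<dots> = (\<Sum>i<m. card (cherries (cyc m g) (g i)))"
    using g by (simp add: sum.reindex cycle_in_def)
  also have "\<dots> = 2 * m"
    using card_nbd_cyc[OF g m] by (simp add: card_cherries)
  finally show ?thesis .
qed

lemma ex_permutation:
  fixes i j :: nat
  assumes "i < n" "j < n" "i \<noteq> j" "i' < n" "j' < n" "i' \<noteq> j'"
  obtains p where "inj p" "\<And>k. k < n \<Longrightarrow> p k < n" "p i = i'" "p j = j'"
proof
  \<comment> \<open>The first swap takes \<open>i\<close> to \<open>i'\<close>; the second takes the
    current image of \<open>j\<close> to \<open>j'\<close> and fixes \<open>i'\<close>, since
    neither of its two points is \<open>i'\<close>.\<close>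
  let ?p = "transpose (transpose i i' j) j' \<circ> transpose i i'"
  show "inj ?p"
    by (intro inj_compose) (auto simp: inj_transpose)
  show "?p k < n" if "k < n" for k
    using that assms by (auto simp: transpose_def)
  show "?p i = i'" "?p j = j'"
    using assms by (auto simp: transpose_def)
qed

definition cherry_count :: "nat \<Rightarrow> nat \<Rightarrow> bool list \<Rightarrow> nat \<Rightarrow> nat \<Rightarrow> nat" where
  "cherry_count n m x i j = card {K \<in> copies (hypercube n) (cycle m). (i, j) \<in> cherries K x}"

text \<open>An automorphism of the cube carries one cherry to the other and maps the copies through
  the first injectively to copies through the second. Exchanging the roles gives equality.\<close>

lemma cherry_count_le:
  assumes x: "length x = n" "i < n" "j < n" "i \<noteq> j"
    and x': "length x' = n" "i' < n" "j' < n" "i' \<noteq> j'" and m: "3 \<le> m"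
  shows "cherry_count n m x i j \<le> cherry_count n m x' i' j'"
proof -
  \<comment> \<open>\<open>p\<close> goes from the new directions to the old ones because
    \<open>f\<close> below fills position \<open>k\<close> from position \<open>p k\<close>.\<close>
  obtain p where p: "inj p" "\<And>k. k < n \<Longrightarrow> p k < n" "p i' = i" "p j' = j"
    using ex_permutation[of i' n j' i j] x x' by metis
  have surj: "\<exists>k<n. a = p k" if "a < n" for a
  proof -
    have "p ` {..<n} = {..<n}"
      using p by (intro card_subset_eq) (auto simp: card_image inj_on_subset)
    then show ?thesis
      using that by (metis imageE lessThan_iff)
  qed
  \<comment> \<open>A permutation of the coordinates followed by the translation that makes
    \<open>f x = x'\<close>.\<close>
  define f where "f y = map (\<lambda>k. (y ! p k) \<noteq> ((x ! p k) \<noteq> (x' ! k))) [0..<n]" for y :: "bool list"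
  have len: "length (f y) = n" for y
    by (simp add: f_def)
  have fx: "f x = x'"
    using x' by (auto simp: f_def list_eq_iff_nth_eq)
  have ftr: "f (tr y {p k}) = tr (f y) {k}" if "length y = n" "k < n" for y k
    using that p by (auto simp: f_def list_eq_iff_nth_eq dest: injD)
  let ?V = "{y :: bool list. length y = n}"
  have inj: "inj_on f ?V"
  proof (rule inj_onI)
    fix y y' assume y: "y \<in> ?V" "y' \<in> ?V" "f y = f y'"
    then have eq: "y ! p k = y' ! p k" if "k < n" for k
      using that by (auto simp: f_def list_eq_iff_nth_eq)
    have "y ! a = y' ! a" if "a < n" for a
      using eq surj[OF that] by auto
    then show "y = y'"
      using y by (simp add: list_eq_iff_nth_eq)
  qed
  have fE: "{f y, f y'} \<in> edges (hypercube n)" if "{y, y'} \<in> edges (hypercube n)" for y y'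
  proof -
    obtain a where a: "a < n" "y' = tr y {a}" "length y = n"
      using \<open>{y, y'} \<in> _\<close> unfolding hypercube_edge_iff by blast
    obtain k where "k < n" "a = p k"
      using surj a by blast
    then show ?thesis
      using a ftr[of y k] by (auto simp: hypercube_edge_iff len)
  qed
  let ?C = "\<lambda>x i j. {K \<in> copies (hypercube n) (cycle m). (i, j) \<in> cherries K x}"
  have "map_graph f ` ?C x i j \<subseteq> ?C x' i' j'"
  proof (rule image_subsetI)
    fix K assume K: "K \<in> ?C x i j"
    then obtain g where g: "cycle_in (hypercube n) m g" "K = cyc m g"
      using copies_cycle[OF simple_graph_hypercube, of m n] m by auto
    have "cycle_in (hypercube n) m (f \<circ> g)"
      using g(1) fE cycle_in_length[OF g(1)] inj unfolding cycle_in_def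
      by (auto intro!: comp_inj_on inj_on_subset[OF inj])
    then have 1: "map_graph f K \<in> copies (hypercube n) (cycle m)"
      using copies_cycle[OF simple_graph_hypercube, of m n] m g by (auto simp: map_graph_cyc)
    have nbd: "k \<in> nbd (map_graph f K) x'" if "p k \<in> nbd K x" "k < n" for k
    proof -
      have "{x, tr x {p k}} \<in> edges K"
        using that by (simp add: nbd_def)
      then have "f ` {x, tr x {p k}} \<in> edges (map_graph f K)"
        unfolding map_graph_def snd_conv by (rule imageI)
      then show ?thesis
        using that x x' ftr[of x k] fx by (simp add: nbd_def)
    qed
    have "(i', j') \<in> cherries (map_graph f K) x'"
      using K nbd[of i'] nbd[of j'] p x' by (auto simp: cherries_def)
    with 1 show "map_graph f K \<in> ?C x' i' j'" by blast
  qed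
  moreover have "inj_on (map_graph f) (?C x i j)"
  proof (rule inj_on_subset[OF inj_on_map_graph[OF inj]])
    have "edges (hypercube n) \<subseteq> Pow ?V"
      using simple_graph_hypercube[of n] by (auto simp: simple_graph_def)
    then show "?C x i j \<subseteq> {K. verts K \<subseteq> ?V \<and> edges K \<subseteq> Pow ?V}"
      by (auto simp: copies_def subgraph_def)
  qed
  moreover have "finite (?C x' i' j')"
    by (rule finite_subset[OF _ finite_copies[OF simple_graph_hypercube]]) auto
  ultimately show ?thesis
    unfolding cherry_count_def by (intro card_inj_on_le)
qed

section \<open>Averaging over cherries and the upper bound\<close>

lemma sum_card_swap:
  assumes "finite A" "finite B"
  shows "(\<Sum>x\<in>A. card {y \<in> B. R x y}) = (\<Sum>y\<in>B. card {x \<in> A. R x y})"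
  using sum.swap_restrict[OF assms, of "\<lambda>_ _. 1::nat" R] by simp

text \<open>Incidences between copies and ordered cherries are counted twice. Every copy has
  \<open>2 * m\<close> cherries; by symmetry every cherry of \<open>Q_n\<close> lies in the same
  number \<open>M\<close> of copies, and a cherry of \<open>G\<close> lies in at most
  \<open>M\<close> copies inside \<open>G\<close>.\<close>

lemma num_copies_le_cherries:
  assumes G: "subgraph G (hypercube n)" and m: "3 \<le> m" and n: "2 \<le> n"
  shows "num_copies G (cycle m) * (2 ^ n * (n * (n - 1)))
    \<le> num_copies (hypercube n) (cycle m) * (\<Sum>x | length x = n. card (cherries G x))"
proof -
  let ?V = "{x :: bool list. length x = n}"
  let ?W = "{(i, j). i < n \<and> j < n \<and> i \<noteq> j}"
  let ?P = "?V \<times> ?W"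
  let ?R = "\<lambda>K (x, c). c \<in> cherries K x"
  have finV: "finite ?V"
    using finite_lists_length_eq[of "UNIV :: bool set" n] by simp
  have finW: "finite ?W"
    by (rule finite_subset[of _ "{..<n} \<times> {..<n}"]) auto
  have cardW: "card ?W = n * (n - 1)"
  proof -
    have "?W = {..<n} \<times> {..<n} - (\<lambda>i. (i, i)) ` {..<n}" by auto
    moreover have "card ((\<lambda>i. (i, i)) ` {..<n}) = n"
      by (subst card_image) (auto simp: inj_on_def)
    ultimately show ?thesis
      by (simp add: card_Diff_subset image_subset_iff diff_mult_distrib2)
  qed
  have sG: "simple_graph G"
    using G by (simp add: subgraph_def)
  have chP: "{q \<in> ?P. ?R K q} = (SIGMA x:?V. cherries K x)" for K
    by (auto simp: cherries_def nbd_def)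
  have finc: "finite (cherries K x)" for K x
    by (rule finite_subset[of _ "nbd K x \<times> nbd K x"]) (auto simp: cherries_def)
  have two: "card {q \<in> ?P. ?R K q} = 2 * m" if K: "K \<in> copies (hypercube n) (cycle m)" for K
  proof -
    obtain g where "cycle_in (hypercube n) m g" "K = cyc m g"
      using K copies_cycle[OF simple_graph_hypercube, of m n] m by auto
    then show ?thesis
      unfolding chP using finV finc sum_cherries_cyc[of n m g] m by (simp add: card_SigmaI)
  qed
  have sub: "copies G (cycle m) \<subseteq> copies (hypercube n) (cycle m)"
    using G by (auto simp: copies_def subgraph_def)
  have fin: "finite (copies (hypercube n) (cycle m))"
    by (rule finite_copies[OF simple_graph_hypercube])
  \<comment> \<open>Any cherry could serve as reference; directions 0 and 1 exist because
    \<open>n >= 2\<close>.\<close>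
  define M where "M = cherry_count n m (replicate n False) 0 1"
  have M: "card {K \<in> copies (hypercube n) (cycle m). ?R K q} = M" if P: "q \<in> ?P" for q
  proof -
    obtain x i j where q: "q = (x, i, j)" "length x = n" "i < n" "j < n" "i \<noteq> j"
      using P by (cases q rule: prod_cases3) auto
    have "cherry_count n m x i j = M"
      unfolding M_def using q n m by (intro antisym cherry_count_le) auto
    then show ?thesis
      by (simp add: q(1) cherry_count_def)
  qed
  have "num_copies (hypercube n) (cycle m) * (2 * m) = (\<Sum>K\<in>copies (hypercube n) (cycle m). card {q \<in> ?P. ?R K q})"
    using two by (simp add: num_copies_def)
  also have "\<dots> = (\<Sum>q\<in>?P. card {K \<in> copies (hypercube n) (cycle m). ?R K q})"
    by (rule sum_card_swap) (use fin finV finW in auto)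
  also have "\<dots> = 2 ^ n * (n * (n - 1)) * M"
    using M by (simp add: card_cartesian_product card_verts_hypercube cardW)
  finally have 1: "num_copies (hypercube n) (cycle m) * (2 * m) = 2 ^ n * (n * (n - 1)) * M" .
  have "num_copies G (cycle m) * (2 * m) = (\<Sum>K\<in>copies G (cycle m). card {q \<in> ?P. ?R K q})"
    using two[OF subsetD[OF sub]] by (simp add: num_copies_def)
  also have "\<dots> = (\<Sum>q\<in>?P. card {K \<in> copies G (cycle m). ?R K q})"
    by (rule sum_card_swap) (use finite_subset[OF sub fin] finV finW in auto)
  \<comment> \<open>A copy inside \<open>G\<close> has only cherries of \<open>G\<close>, so all
    other incidences vanish.\<close>
  also have "\<dots> = (\<Sum>q\<in>{q \<in> ?P. ?R G q}. card {K \<in> copies G (cycle m). ?R K q})"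
  proof (rule sum.mono_neutral_right)
    show "\<forall>q\<in>?P - {q \<in> ?P. ?R G q}. card {K \<in> copies G (cycle m). ?R K q} = 0"
    proof
      fix q assume q: "q \<in> ?P - {q \<in> ?P. ?R G q}"
      have "cherries K x \<subseteq> cherries G x" if "K \<in> copies G (cycle m)" for K x
        using that by (auto simp: copies_def subgraph_def cherries_def nbd_def)
      then have "{K \<in> copies G (cycle m). ?R K q} = {}"
        using q by fastforce
      then show "card {K \<in> copies G (cycle m). ?R K q} = 0" by (simp only: card.empty)
    qed
  qed (use finV finW in auto)
  also have "\<dots> \<le> (\<Sum>q\<in>{q \<in> ?P. ?R G q}. M)"
  proof (rule sum_mono)
    fix q assume q: "q \<in> {q \<in> ?P. ?R G q}"
    have "card {K \<in> copies G (cycle m). ?R K q} \<le> card {K \<in> copies (hypercube n) (cycle m). ?R K q}"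
      using sub fin by (intro card_mono) auto
    then show "card {K \<in> copies G (cycle m). ?R K q} \<le> M"
      using M q by simp
  qed
  also have "\<dots> = (\<Sum>x\<in>?V. card (cherries G x)) * M"
    unfolding chP using finV finc by (simp add: card_SigmaI)
  finally have 2: "num_copies G (cycle m) * (2 * m) \<le> (\<Sum>x\<in>?V. card (cherries G x)) * M" .
  have "num_copies G (cycle m) * (2 ^ n * (n * (n - 1))) * (2 * m)
      = num_copies G (cycle m) * (2 * m) * (2 ^ n * (n * (n - 1)))" by simp
  also have "\<dots> \<le> (\<Sum>x\<in>?V. card (cherries G x)) * M * (2 ^ n * (n * (n - 1)))"
    using 2 by (rule mult_right_mono) simp
  also have "\<dots> = (\<Sum>x\<in>?V. card (cherries G x)) * (2 ^ n * (n * (n - 1)) * M)"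
    by simp
  also have "\<dots> = num_copies (hypercube n) (cycle m) * (\<Sum>x\<in>?V. card (cherries G x)) * (2 * m)"
    unfolding 1[symmetric] by simp
  finally show ?thesis
    using m by simp
qed

lemma copy_density_upper:
  assumes m: "3 \<le> m" and n: "62 \<le> n"
  shows "copy_density (hypercube n) (cycle m) (cycle 6) \<le> 0.36577"
proof -
  let ?N = "num_copies (hypercube n) (cycle m)"
  have "edges (cycle 6) \<noteq> {}"
    by (auto simp: cycle_def intro: exI[of _ 0])
  from ex_copies_in[OF simple_graph_hypercube this simple_graph_cycle, of n "cycle m"]
  obtain G where G: "subgraph G (hypercube n)" "free_of G (cycle 6)"
    and ex: "ex_copies (hypercube n) (cycle m) (cycle 6) = num_copies G (cycle m)"
    by auto
  define W where "W = 2 ^ n * (real n * (real n - 1))"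
  have W: "W > 0"
    using n by (simp add: W_def)
  have "simple_graph G"
    using G by (simp add: subgraph_def)
  then have free: "\<nexists>g. cycle_in G 6 g"
    using G free_of_cycle[of G 6] by simp
  have "real (num_copies G (cycle m)) * W
      = real (num_copies G (cycle m) * (2 ^ n * (n * (n - 1))))"
    using n by (simp add: W_def of_nat_diff)
  also have "\<dots> \<le> real (?N * (\<Sum>x | length x = n. card (cherries G x)))"
    using num_copies_le_cherries[OF G(1) m, of] n by (intro of_nat_mono) simp
  also have "\<dots> = real ?N * real (\<Sum>x | length x = n. card (cherries G x))"
    by simp
  also have "\<dots> \<le> real ?N * (W * (1 / 3 + 2 / real n))"
    unfolding W_def by (intro mult_left_mono cherries_bound[OF free]) (use n in auto)
  finally have "real (num_copies G (cycle m)) \<le> real ?N * (1 / 3 + 2 / real n)"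
    using W by (simp add: mult.left_commute[of _ W] mult.commute[of _ W])
  \<comment> \<open>62 is the least \<open>n\<close> with
    \<open>1/3 + 2/n <= 0.36577\<close>.\<close>
  also have "2 / real n \<le> 2 / 62"
    using n by (intro divide_left_mono) auto
  then have "real ?N * (1 / 3 + 2 / real n) \<le> real ?N * 0.36577"
    by (intro mult_left_mono) auto
  finally show ?thesis
    \<comment> \<open>If \<open>Q_n\<close> has no copy at all, the density is 0 by the convention
      for division by zero.\<close>
    unfolding copy_density_def ex by (cases "?N = 0") (simp_all add: divide_le_eq)
qed

section \<open>A family of hexagon-free subgraphs\<close>

text \<open>Read: \<open>a\<close> sees \<open>u\<close>. It is the usual order when
  \<open>B\<close> is empty; the twist on \<open>B\<close> admits cyclic patterns of odd length
  without losing \<open>above_triangle\<close>.\<close>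

definition above :: "nat set \<Rightarrow> nat \<Rightarrow> nat \<Rightarrow> bool" where
  "above B a u \<longleftrightarrow> (if a \<in> B then (if u \<in> B then a < u else u < a) else u \<notin> B \<and> a < u)"

text \<open>If all three lie on the same side of \<open>B\<close>, the middle one sees only the
  largest. If exactly one lies in \<open>B\<close>, the smaller of the other two sees the larger but
  not the element of \<open>B\<close>. If exactly \<open>b < c\<close> lie in \<open>B\<close>, then
  \<open>b\<close> sees \<open>c\<close>, so the third is below \<open>b\<close>, while
  \<open>c\<close> does not see \<open>b\<close>, so the third is not below
  \<open>c\<close>.\<close>

lemma above_triangle:
  assumes "p \<noteq> q" "q \<noteq> s" "p \<noteq> s"
    and "above B p q = above B p s" "above B q p = above B q s" "above B s p = above B s q"
  shows False
  using assms unfolding above_def by (auto split: if_splits)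

lemma above_Int: "a \<in> S \<Longrightarrow> u \<in> S \<Longrightarrow> above (B \<inter> S) a u = above B a u"
  by (simp add: above_def)

lemma above_image:
  assumes "strict_mono_on S s" "a \<in> S" "u \<in> S" "P \<subseteq> S"
  shows "above (s ` P) (s a) (s u) = above P a u"
proof -
  have "s x \<in> s ` P \<longleftrightarrow> x \<in> P" if "x \<in> S" for x
    using that assms strict_mono_on_imp_inj_on[OF assms(1)] by (auto simp: inj_on_def)
  moreover have "s x < s y \<longleftrightarrow> x < y" if "x \<in> S" "y \<in> S" for x y
    using that strict_mono_on_less[OF assms(1)] by blast
  ultimately show ?thesis
    using assms by (simp add: above_def)
qed

section \<open>Cyclic orders in which every element sees its two neighbours alike\<close>

text \<open>The lower half of the range goes to the odd positions and the upper half to the even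
  ones, so low elements see both neighbours and high elements see neither. Over all
  \<open>i\<close>, the two conjuncts say that position \<open>i\<close> sees successor and
  predecessor with the common value \<open>odd i\<close>.\<close>

lemma alternating_order_even:
  assumes "even l" "4 \<le> l"
  obtains a where "bij_betw a {..<l} {..<l}"
    "\<And>i. i < l \<Longrightarrow> above {} (a i) (a (Suc i mod l)) = odd i \<and>
      above {} (a (Suc i mod l)) (a i) = odd (Suc i mod l)"
proof -
  obtain h where l: "l = 2 * h"
    using assms by auto
  define a where "a i = (if odd i then i div 2 else h + i div 2)" for i
  have low: "odd i \<Longrightarrow> i < l \<Longrightarrow> a i < h" and high: "even i \<Longrightarrow> h \<le> a i" for i
    using l by (auto simp: a_def)
  have "inj_on a {..<l}"
  proof (rule inj_onI)
    fix i j assume ij: "i \<in> {..<l}" "j \<in> {..<l}" "a i = a j"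
    have "odd i = odd j"
      using low[of i] low[of j] high[of i] high[of j] ij by fastforce
    moreover have "i div 2 = j div 2"
      using ij(3) calculation by (auto simp: a_def split: if_splits)
    ultimately show "i = j"
      by (metis odd_two_times_div_two_succ dvd_mult_div_cancel)
  qed
  moreover have "a ` {..<l} \<subseteq> {..<l}"
    using l by (auto simp: a_def)
  ultimately have bij: "bij_betw a {..<l} {..<l}"
    by (simp add: bij_betw_def card_image card_subset_eq)
  have "above {} (a i) (a (Suc i mod l)) = odd i \<and> above {} (a (Suc i mod l)) (a i) = odd (Suc i mod l)"
    if "i < l" for i
  proof -
    have par: "odd (Suc i mod l) = even i" "Suc i mod l < l"
      using that l assms by (auto simp: mod_Suc) presburger
    show ?thesis
    proof (cases "even i")
      case True
      then show ?thesis
        using high[of i] low[of "Suc i mod l"] par by (simp add: above_def)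
    next
      case False
      then show ?thesis
        using low[of i] high[of "Suc i mod l"] par that by (simp add: above_def)
    qed
  qed
  with bij show thesis
    using that by blast
qed

text \<open>With \<open>k = (l - 3) / 2\<close>, the cyclic order is \<open>k+2, k+1, k\<close> followed by alternating elements of
  \<open>{..<k}\<close> and \<open>{k+3..<l}\<close>. The first edge is the only one whose ends both see each other as
  not above, and this odd defect is what allows a cycle of odd length.\<close>

lemma alternating_order_odd:
  assumes "odd l" "4 \<le> l"
  obtains P a where "P \<subseteq> {..<l}" "bij_betw a {..<l} {..<l}"
    "\<And>i. i < l \<Longrightarrow> above P (a i) (a (Suc i mod l)) = odd i \<and>
      above P (a (Suc i mod l)) (a i) = odd (Suc i mod l)"
proof -
  define k where "k = (l - 3) div 2"
  have l: "l = 2 * k + 3" and k: "k \<ge> 1"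
    using assms unfolding k_def by presburger+
  \<comment> \<open>\<open>k + 1\<close>, at position 1, has to see both \<open>k + 2\<close> and
    \<open>k\<close>, hence one larger and one smaller element; putting \<open>k + 1\<close> and
    \<open>k + 2\<close> into \<open>P\<close> but not \<open>k\<close> achieves this.\<close>
  define P where "P = {Suc k, k + 2}"
  define a where "a i = (if i < 3 then k + 2 - i else if odd i then (i - 3) div 2 else k + 1 + i div 2)" for i
  have a: "a 0 = k + 2" "a 1 = Suc k" "a 2 = k"
    by (auto simp: a_def)
  have low: "a i < k" if "odd i" "i < l" "3 \<le> i" for i
    using that l by (auto simp: a_def)
  have high: "k + 3 \<le> a i" "a i < l" if even: "even i" and "i < l" "3 \<le> i" for i
  proof -
    obtain j where "i = 2 * j" using even by blast
    then show "k + 3 \<le> a i" "a i < l" using that l by (auto simp: a_def)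
  qed
  have mid: "k \<le> a i" "a i < k + 3" if "i < 3" for i
    using that by (auto simp: a_def)
  \<comment> \<open>The value \<open>a i\<close> reveals the block of \<open>i\<close>, so
    injectivity can be checked block by block.\<close>
  have cls: "(3 \<le> i \<and> odd i \<longleftrightarrow> a i < k) \<and> (3 \<le> i \<and> even i \<longleftrightarrow> k + 3 \<le> a i)" if "i < l" for i
    using low[of i] high[of i] mid[of i] that by (cases "i < 3"; cases "odd i") auto
  have "inj_on a {..<l}"
  proof (rule inj_onI)
    fix i j assume ij: "i \<in> {..<l}" "j \<in> {..<l}" "a i = a j"
    have "odd i = odd j \<and> 3 \<le> i \<and> 3 \<le> j \<or> i < 3 \<and> j < 3"
      using cls[of i] cls[of j] ij by (cases "i < 3"; cases "j < 3"; cases "odd i"; cases "odd j") auto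
    then consider "i < 3" "j < 3" | "3 \<le> i" "3 \<le> j" "odd i" "odd j" | "3 \<le> i" "3 \<le> j" "even i" "even j"
      by blast
    then show "i = j"
    proof cases
      case 1
      then show ?thesis using ij(3) by (auto simp: a_def)
    next
      case 2
      then have "(i - 3) div 2 = (j - 3) div 2" "even (i - 3)" "even (j - 3)"
        using ij(3) by (auto simp: a_def)
      then have "i - 3 = j - 3"
        by (metis dvd_mult_div_cancel)
      then show ?thesis using 2 by simp
    next
      case 3
      then have "i div 2 = j div 2"
        using ij(3) by (auto simp: a_def)
      then show ?thesis using 3 by (metis dvd_mult_div_cancel)
    qed
  qed
  moreover have "a ` {..<l} \<subseteq> {..<l}"
  proof (rule image_subsetI)
    fix i assume "i \<in> {..<l}"
    then show "a i \<in> {..<l}"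
      using low[of i] high(2)[of i] mid(2)[of i] l k by (cases "i < 3"; cases "odd i") auto
  qed
  ultimately have bij: "bij_betw a {..<l} {..<l}"
    by (simp add: bij_betw_def card_image card_subset_eq)
  have "above P (a i) (a (Suc i mod l)) = odd i \<and> above P (a (Suc i mod l)) (a i) = odd (Suc i mod l)"
    if i: "i < l" for i
  proof -
    consider "i = 0" | "i = 1" | "i = 2" | "3 \<le> i" "Suc i < l" | "Suc i = l"
      using i by linarith
    then show ?thesis
    proof cases
      case 4
      then have S: "Suc i mod l = Suc i" by simp
      show ?thesis
      proof (cases "odd i")
        case True
        then show ?thesis
          using low[of i] high[of "Suc i"] 4 unfolding S by (auto simp: above_def P_def)
      next
        case False
        then show ?thesis
          using high[of i] low[of "Suc i"] 4 unfolding S by (auto simp: above_def P_def)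
      qed
    next
      \<comment> \<open>The closing edge joins the even positions \<open>l - 1\<close> and 0, so
        neither end may see the other: the large element lies outside \<open>P\<close> and does not
        see into \<open>P\<close>, and \<open>k + 2\<close> sees only smaller elements outside
        \<open>P\<close>.\<close>
      case 5
      then have "Suc i mod l = 0" by simp
      moreover have "even i" "3 \<le> i"
        using 5 l k by auto
      ultimately show ?thesis
        using high[of i] a i by (auto simp: above_def P_def)
    next
      case 3
      then have "Suc i mod l = 3" using l k by simp
      then show ?thesis
        using 3 low[of 3] a l k by (auto simp: above_def P_def)
    next
      case 1
      then have "Suc i mod l = 1" using l k by simp
      then show ?thesis
        using 1 a(1,2) by (simp add: above_def P_def)
    next
      case 2
      then have "Suc i mod l = 2" using l k by simp
      then show ?thesis
        using 2 a(2,3) by (simp add: above_def P_def)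
    qed
  qed
  moreover have "P \<subseteq> {..<l}"
    using l k by (auto simp: P_def)
  ultimately show thesis
    using that bij by blast
qed

text \<open>\<open>above\<close> depends only on relative order and on membership in its set, so the
  patterns on \<open>{..<l}\<close> transfer along the increasing enumeration of
  \<open>S\<close>.\<close>

lemma alternating_order:
  assumes "finite S" "card S = l" "4 \<le> l"
  obtains P a where "P \<subseteq> S" "bij_betw a {..<l} S"
    "\<And>i. i < l \<Longrightarrow> above P (a i) (a (Suc i mod l)) = odd i \<and>
      above P (a (Suc i mod l)) (a i) = odd (Suc i mod l)"
proof -
  obtain Q b where Q: "Q \<subseteq> {..<l}" and b: "bij_betw b {..<l} {..<l}"
    and ab: "\<And>i. i < l \<Longrightarrow> above Q (b i) (b (Suc i mod l)) = odd i \<and>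
      above Q (b (Suc i mod l)) (b i) = odd (Suc i mod l)"
  proof (cases "even l")
    case True
    show ?thesis
      by (rule alternating_order_even[OF True assms(3)]) (rule that[of "{}"], auto)
  next
    case False
    show ?thesis
      by (rule alternating_order_odd[OF False assms(3)]) (rule that, auto)
  qed
  let ?s = "(!) (sorted_list_of_set S)"
  have s: "bij_betw ?s {..<l} S"
    using assms by (intro bij_betw_nth) auto
  have mono: "strict_mono_on {..<l} ?s"
    using assms by (intro strict_mono_onI) (simp add: sorted_wrt_nth_less[OF strict_sorted_list_of_set])
  have bl: "b i < l" if "i < l" for i
    using b that by (auto simp: bij_betw_def)
  show thesis
  proof (rule that[of "?s ` Q" "?s \<circ> b"])
    show "?s ` Q \<subseteq> S"
      using s Q by (auto simp: bij_betw_def)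
    show "bij_betw (?s \<circ> b) {..<l} S"
      using b s by (rule bij_betw_trans)
    fix i assume i: "i < l"
    then have "Suc i mod l < l" by simp
    then show "above (?s ` Q) ((?s \<circ> b) i) ((?s \<circ> b) (Suc i mod l)) = odd i \<and>
        above (?s ` Q) ((?s \<circ> b) (Suc i mod l)) ((?s \<circ> b) i) = odd (Suc i mod l)"
      using ab[OF i] i bl Q by (simp add: above_image[OF mono])
  qed
qed

section \<open>The arc graphs and their freeness from hexagons\<close>

abbreviation vec :: "nat \<Rightarrow> nat set \<Rightarrow> bool list" where
  "vec n A \<equiv> tr (replicate n False) A"

definition up_arc :: "bool \<Rightarrow> nat set \<Rightarrow> nat set \<Rightarrow> nat set \<Rightarrow> nat \<Rightarrow> bool" where
  "up_arc r B C A a \<longleftrightarrow> a \<notin> A \<and> odd (card A) = r \<and> odd (card {u \<in> A. above B a u}) = (a \<in> C)"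

definition arc_graph :: "nat \<Rightarrow> bool \<Rightarrow> nat set \<Rightarrow> nat set \<Rightarrow> bool list graph" where
  "arc_graph n r B C = ({x. length x = n},
     {{vec n A, vec n (insert a A)} | A a. A \<subseteq> {..<n} \<and> a < n \<and> up_arc r B C A a})"

lemma subgraph_arc_graph: "subgraph (arc_graph n r B C) (hypercube n)"
proof -
  have "edges (arc_graph n r B C) \<subseteq> edges (hypercube n)"
  proof
    fix e assume "e \<in> edges (arc_graph n r B C)"
    then obtain A a where e: "e = {vec n A, vec n (insert a A)}" "a < n" "a \<notin> A"
      by (auto simp: arc_graph_def up_arc_def)
    then have "e = {vec n A, tr (vec n A) {a}}"
      by (simp add: tr_insert)
    then show "e \<in> edges (hypercube n)"
      using e(2) by (auto simp: hypercube_edge_iff)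
  qed
  then show ?thesis
    using simple_graph_hypercube[of n] by (auto simp: subgraph_def simple_graph_def arc_graph_def)
qed

lemma odd_card_insert:
  assumes "finite T" "x \<notin> T"
  shows "odd (card {u \<in> insert x T. R u}) = (odd (card {u \<in> T. R u}) \<noteq> R x)"
proof -
  have "{u \<in> insert x T. R u} = (if R x then insert x {u \<in> T. R u} else {u \<in> T. R u})"
    by auto
  then show ?thesis
    using assms by auto
qed

text \<open>Both arcs prescribe the same parity at \<open>a\<close>. The contributions of
  \<open>T\<close> agree, so those of \<open>x\<close> and \<open>y\<close> must agree too.\<close>

lemma up_arc_exchange:
  assumes "up_arc r B C (insert x T) a" "up_arc r B C (insert y T) a"
    and "finite T" "x \<notin> T" "y \<notin> T"
  shows "above B a x = above B a y"
  using odd_card_insert[of T x "above B a"] odd_card_insert[of T y "above B a"] assms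
  unfolding up_arc_def by metis

text \<open>The lower sets turn out to be \<open>T\<close> plus one of three coordinates and the
  upper sets \<open>T\<close> plus two of them. Each coordinate is added to both lower sets that
  lack it, so by \<open>up_arc_exchange\<close> it sees the other two alike, against
  \<open>above_triangle\<close>.\<close>

lemma no_hexagon:
  assumes fin: "finite A0"
    and up: "up_arc r B C A0 a1" "up_arc r B C A2 b1" "up_arc r B C A2 a3"
      "up_arc r B C A4 b3" "up_arc r B C A4 a5" "up_arc r B C A0 b5"
    and U: "U1 = insert a1 A0" "U1 = insert b1 A2" "U3 = insert a3 A2" "U3 = insert b3 A4"
      "U5 = insert a5 A4" "U5 = insert b5 A0"
    and dist: "distinct [A0, U1, A2, U3, A4, U5]"
  shows False
proof -
  have eq: "insert a1 A0 = insert b1 A2" "insert a3 A2 = insert b3 A4" "insert a5 A4 = insert b5 A0"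
    using U by simp_all
  have neq: "A0 \<noteq> A2" "A2 \<noteq> A4" "A4 \<noteq> A0"
      "insert a1 A0 \<noteq> insert a3 A2" "insert a3 A2 \<noteq> insert a5 A4" "insert a5 A4 \<noteq> insert a1 A0"
    using dist unfolding U(1,3,5)[symmetric] by auto
  have notin: "a1 \<notin> A0" "b1 \<notin> A2" "a3 \<notin> A2" "b3 \<notin> A4" "a5 \<notin> A4" "b5 \<notin> A0"
    using up by (auto simp: up_arc_def)
  define T where "T = A0 - {b1}"
  have ab: "a1 \<noteq> b1"
    using eq(1) neq(1) notin by (metis insert_ident)
  have A0: "A0 = insert b1 T" "b1 \<notin> T" "a1 \<notin> T"
    using eq(1) ab notin by (auto simp: T_def)
  have A2: "A2 = insert a1 T"
    using eq(1) ab notin by (auto simp: T_def)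
  have "a3 \<noteq> b1" "b5 \<noteq> a1"
    using neq(4,6) eq by auto
  have "b3 \<noteq> a3"
    using eq(2) neq(2) notin by (metis insert_ident)
  \<comment> \<open>\<open>A4\<close> lies in \<open>U5\<close>, which is \<open>A0\<close> plus
    \<open>b5\<close> and so avoids \<open>a1\<close>. As \<open>U3\<close> contains
    \<open>a1\<close>, the element added to \<open>A4\<close> must be \<open>a1\<close>.\<close>
  have "a1 \<notin> A4"
    using eq(3) A0 ab \<open>b5 \<noteq> a1\<close> by auto
  then have b3: "b3 = a1"
    using eq(2) A2 by auto
  then have A4: "A4 = insert a3 T" "a3 \<notin> T"
    using eq(2) A2 notin A0 by auto
  then have b5: "b5 = a3" and a5: "a5 = b1"
    using eq(3) A0 \<open>a3 \<noteq> b1\<close> notin by auto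
  have "a3 \<noteq> a1"
    using notin A2 by auto
  have "finite T"
    using fin by (simp add: T_def)
  have "above B a1 b1 = above B a1 a3"
    using up_arc_exchange[of r B C b1 T a1 a3] up A0 A4 b3 \<open>finite T\<close> by simp
  moreover have "above B b1 a1 = above B b1 a3"
    using up_arc_exchange[of r B C a1 T b1 a3] up A0 A2 A4 a5 \<open>finite T\<close> by simp
  moreover have "above B a3 a1 = above B a3 b1"
    using up_arc_exchange[of r B C a1 T a3 b1] up A0 A2 b5 \<open>finite T\<close> by simp
  ultimately show False
    using above_triangle[of a1 b1 a3 B] ab \<open>a3 \<noteq> b1\<close> \<open>a3 \<noteq> a1\<close> by auto
qed

text \<open>The ends of an edge have sizes of different parity, and the end of parity
  \<open>r\<close> is the lower one. Whether a vertex is a lower end thus depends on the vertex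
  alone.\<close>

lemma arc_graph_edgeD:
  assumes "{vec n X, vec n Y} \<in> edges (arc_graph n r B C)" "X \<subseteq> {..<n}" "Y \<subseteq> {..<n}"
  shows "(odd (card X) = r \<and> odd (card Y) \<noteq> r \<and> (\<exists>a. Y = insert a X \<and> up_arc r B C X a)) \<or>
    (odd (card X) \<noteq> r \<and> odd (card Y) = r \<and> (\<exists>a. X = insert a Y \<and> up_arc r B C Y a))"
proof -
  obtain A a where A: "{vec n X, vec n Y} = {vec n A, vec n (insert a A)}" "A \<subseteq> {..<n}" "a < n"
    "up_arc r B C A a"
    using assms(1) unfolding arc_graph_def by auto
  have "finite A"
    using A(2) finite_subset by blast
  then have "odd (card A) = r" "odd (card (insert a A)) \<noteq> r"
    using A(4) by (auto simp: up_arc_def)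
  moreover have "X = A \<and> Y = insert a A \<or> X = insert a A \<and> Y = A"
    using A assms(2,3) by (auto simp: doubleton_eq_iff tr_eq_iff)
  ultimately show ?thesis
    using A(4) by blast
qed

text \<open>Lower and upper vertices alternate along a cycle, so either the even or the odd
  positions are the lower ones; the second case is the first after a rotation by one.\<close>

lemma arc_graph_hexagon_free: "\<nexists>g. cycle_in (arc_graph n r B C) 6 g"
proof
  let ?E = "edges (arc_graph n r B C)"
  assume "\<exists>g. cycle_in (arc_graph n r B C) 6 g"
  then obtain g where g: "cycle_in (arc_graph n r B C) 6 g" by blast
  then have "cycle_in (hypercube n) 6 g"
    using subgraph_arc_graph cycle_in_mono by (metis subgraph_def)
  then have "\<forall>i<6. \<exists>A. A \<subseteq> {..<n} \<and> g i = vec n A"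
    using cycle_in_length ex_tr[of _ "replicate n False"] by (metis length_replicate)
  then obtain X where X: "\<And>i. i < 6 \<Longrightarrow> X i \<subseteq> {..<n} \<and> g i = vec n (X i)"
    by metis
  have "X i \<noteq> X j" if "i < 6" "j < 6" "i \<noteq> j" for i j
    using that X g by (metis cycle_in_def inj_onD lessThan_iff)
  have six: "i < 6 \<longleftrightarrow> i = 0 \<or> i = 1 \<or> i = 2 \<or> i = 3 \<or> i = 4 \<or> i = 5" for i :: nat
    by auto
  have neq: "distinct [X 0, X 1, X 2, X 3, X 4, X 5]"
    using \<open>\<And>i j. i < 6 \<Longrightarrow> j < 6 \<Longrightarrow> i \<noteq> j \<Longrightarrow> X i \<noteq> X j\<close> by simp
  have fin: "finite (X 0)" "finite (X 1)"
    using X[of 0] X[of 1] finite_subset by auto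
  have E: "{vec n (X i), vec n (X (Suc i mod 6))} \<in> ?E" if "i < 6" for i
    using g that X[of i] X[of "Suc i mod 6"] by (auto simp: cycle_in_def)
  define low where "low i \<longleftrightarrow> odd (card (X i)) = r" for i
  define up where "up i j \<longleftrightarrow> (\<exists>a. X j = insert a (X i) \<and> up_arc r B C (X i) a)" for i j
  have D: "low i \<and> \<not> low (Suc i mod 6) \<and> up i (Suc i mod 6) \<or>
      \<not> low i \<and> low (Suc i mod 6) \<and> up (Suc i mod 6) i" if "i < 6" for i
    using arc_graph_edgeD[OF E[OF that]] X that unfolding low_def up_def by simp
  have D0: "low 0 \<and> \<not> low 1 \<and> up 0 1 \<or> \<not> low 0 \<and> low 1 \<and> up 1 0"
    using D[of 0] by simp
  have D1: "low 1 \<and> \<not> low 2 \<and> up 1 2 \<or> \<not> low 1 \<and> low 2 \<and> up 2 1"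
    using D[of 1] by (simp add: numeral_2_eq_2)
  have D2: "low 2 \<and> \<not> low 3 \<and> up 2 3 \<or> \<not> low 2 \<and> low 3 \<and> up 3 2"
    using D[of 2] by simp
  have D3: "low 3 \<and> \<not> low 4 \<and> up 3 4 \<or> \<not> low 3 \<and> low 4 \<and> up 4 3"
    using D[of 3] by simp
  have D4: "low 4 \<and> \<not> low 5 \<and> up 4 5 \<or> \<not> low 4 \<and> low 5 \<and> up 5 4"
    using D[of 4] by simp
  have D5: "low 5 \<and> \<not> low 0 \<and> up 5 0 \<or> \<not> low 5 \<and> low 0 \<and> up 0 5"
    using D[of 5] by simp
  note D6 = D0 D1 D2 D3 D4 D5
  show False
  proof (cases "low 0")
    case True
    then have "up 0 1" "up 2 1" "up 2 3" "up 4 3" "up 4 5" "up 0 5"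
      using D6 by blast+
    then obtain a1 b1 a3 b3 a5 b5 where
      up: "up_arc r B C (X 0) a1" "up_arc r B C (X 2) b1" "up_arc r B C (X 2) a3"
        "up_arc r B C (X 4) b3" "up_arc r B C (X 4) a5" "up_arc r B C (X 0) b5"
      and U: "X 1 = insert a1 (X 0)" "X 1 = insert b1 (X 2)" "X 3 = insert a3 (X 2)"
        "X 3 = insert b3 (X 4)" "X 5 = insert a5 (X 4)" "X 5 = insert b5 (X 0)"
      unfolding up_def by metis
    show False
      by (rule no_hexagon[OF fin(1) up U neq])
  next
    case False
    then have "up 1 2" "up 3 2" "up 3 4" "up 5 4" "up 5 0" "up 1 0"
      using D6 by blast+
    then obtain a1 b1 a3 b3 a5 b5 where
      up: "up_arc r B C (X 1) a1" "up_arc r B C (X 3) b1" "up_arc r B C (X 3) a3"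
        "up_arc r B C (X 5) b3" "up_arc r B C (X 5) a5" "up_arc r B C (X 1) b5"
      and U: "X 2 = insert a1 (X 1)" "X 2 = insert b1 (X 3)" "X 4 = insert a3 (X 3)"
        "X 4 = insert b3 (X 5)" "X 0 = insert a5 (X 5)" "X 0 = insert b5 (X 1)"
      unfolding up_def by metis
    have "distinct [X 1, X 2, X 3, X 4, X 5, X 0]"
      using neq distinct1_rotate[of "[X 0, X 1, X 2, X 3, X 4, X 5]"]
      by (simp only: rotate1.simps append.simps)
    then show False
      by (rule no_hexagon[OF fin(2) up U])
  qed
qed

section \<open>Counting cycles in the family\<close>

text \<open>The closed walk alternating between the vertices and the edges of the cyclic order
  \<open>a\<close>, each united with \<open>T\<close>.\<close>

definition zigzag :: "nat \<Rightarrow> (nat \<Rightarrow> nat) \<Rightarrow> nat set \<Rightarrow> nat \<Rightarrow> nat set" where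
  "zigzag l a T j = (if even j then insert (a (j div 2)) T
     else insert (a (Suc (j div 2) mod l)) (insert (a (j div 2)) T))"

text \<open>For \<open>l = 2\<close> the two edges would coincide.\<close>

lemma cycle_edge_inj:
  assumes "3 \<le> l" "i < l" "j < l" "{i, Suc i mod l} = {j, Suc j mod l}"
  shows "i = j"
  using assms by (auto simp: doubleton_eq_iff mod_Suc split: if_splits)

lemma zigzag_subset:
  assumes "a ` {..<l} \<subseteq> {..<n}" "T \<subseteq> {..<n}" "j < 2 * l"
  shows "zigzag l a T j \<subseteq> {..<n}"
proof -
  have "j div 2 < l" "Suc (j div 2) mod l < l"
    using assms(3) by auto
  then have "a (j div 2) \<in> {..<n}" "a (Suc (j div 2) mod l) \<in> {..<n}"
    using assms(1) by blast+
  then show ?thesis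
    using assms(2) by (auto simp: zigzag_def)
qed

text \<open>The cardinality reveals the parity of the position; removing \<open>T\<close> leaves a
  vertex or an edge of the \<open>l\<close>-cycle, which reveals the index.\<close>

lemma zigzag_inj:
  assumes a: "bij_betw a {..<l} S" and l: "3 \<le> l" and T: "T \<inter> S = {}" "finite T"
  shows "inj_on (zigzag l a T) {..<2 * l}"
proof (rule inj_onI)
  fix j k assume jk: "j \<in> {..<2 * l}" "k \<in> {..<2 * l}" "zigzag l a T j = zigzag l a T k"
  have inj: "a i = a i' \<longleftrightarrow> i = i'" if "i < l" "i' < l" for i i'
    using a that by (auto simp: bij_betw_def inj_on_def)
  have aT: "a i \<notin> T" if "i < l" for i
    using a T that by (auto simp: bij_betw_def)
  have lt: "i div 2 < l" "Suc (i div 2) mod l < l" if "i \<in> {..<2 * l}" for i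
    using that by auto
  have neq: "Suc i mod l \<noteq> i" if "i < l" for i
    using that l by (intro Suc_mod_neq) auto
  have card: "card (zigzag l a T i) = card T + (if even i then 1 else 2)" if "i \<in> {..<2 * l}" for i
    using lt[OF that] aT T(2) inj neq by (auto simp: zigzag_def)
  have minus: "zigzag l a T i - T = a ` (if even i then {i div 2} else {i div 2, Suc (i div 2) mod l})"
    if "i \<in> {..<2 * l}" for i
    using lt[OF that] aT by (auto simp: zigzag_def)
  have par: "even j = even k"
    using card[OF jk(1)] card[OF jk(2)] jk(3) by (auto split: if_splits)
  let ?D = "\<lambda>i. if even i then {i div 2} else {i div 2, Suc (i div 2) mod l}"
  have "a ` ?D j = a ` ?D k"
    using minus[OF jk(1)] minus[OF jk(2)] jk(3) by simp
  moreover have "inj_on a {..<l}"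
    using a by (simp add: bij_betw_def)
  ultimately have "?D j = ?D k"
    using lt[OF jk(1)] lt[OF jk(2)] by (subst (asm) inj_on_image_eq_iff) auto
  then have "j div 2 = k div 2"
    using par cycle_edge_inj[OF l, of "j div 2" "k div 2"] lt[OF jk(1)] lt[OF jk(2)]
    by (auto split: if_splits)
  with par show "j = k"
    by (metis dvd_mult_div_cancel odd_two_times_div_two_succ)
qed

lemma Inter_zigzag:
  assumes a: "bij_betw a {..<l} S" and l: "3 \<le> l"
  shows "(\<Inter>j<2 * l. zigzag l a T j) = T"
proof
  show "T \<subseteq> (\<Inter>j<2 * l. zigzag l a T j)"
    by (auto simp: zigzag_def)
  have inj: "a 0 \<noteq> a 1"
    using bij_betw_imp_inj_on[OF a] l inj_on_eq_iff[of a "{..<l}" 0 1] by simp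
  have "(\<Inter>j<2 * l. zigzag l a T j) \<subseteq> zigzag l a T 0 \<inter> zigzag l a T 2"
    using l by auto
  also have "\<dots> = T"
    using inj by (auto simp: zigzag_def)
  finally show "(\<Inter>j<2 * l. zigzag l a T j) \<subseteq> T" .
qed

lemma Union_zigzag:
  assumes a: "bij_betw a {..<l} S" and l: "3 \<le> l"
  shows "(\<Union>j<2 * l. zigzag l a T j) = S \<union> T"
proof
  have S: "a ` {..<l} = S"
    using a by (simp add: bij_betw_def)
  show "(\<Union>j<2 * l. zigzag l a T j) \<subseteq> S \<union> T"
    using l unfolding S[symmetric] by (auto simp: zigzag_def split: if_splits)
  show "S \<union> T \<subseteq> (\<Union>j<2 * l. zigzag l a T j)"
  proof
    fix x assume x: "x \<in> S \<union> T"
    show "x \<in> (\<Union>j<2 * l. zigzag l a T j)"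
    proof (cases "x \<in> T")
      case True
      then show ?thesis
        using l by (intro UN_I[of 0]) (auto simp: zigzag_def)
    next
      case False
      then obtain i where "i < l" "x = a i"
        using x S by auto
      then show ?thesis
        by (intro UN_I[of "2 * i"]) (auto simp: zigzag_def)
    qed
  qed
qed

text \<open>The vertices of the copy have intersection \<open>T\<close> and union
  \<open>S \<union> T\<close>, so the copy determines the pair even though the labelling is
  lost.\<close>

lemma zigzag_cyc_inj:
  assumes a: "bij_betw a {..<l} S" and a': "bij_betw a' {..<l} S'" and l: "3 \<le> l"
    and S: "S \<subseteq> {..<n}" "T \<subseteq> {..<n} - S" and S': "S' \<subseteq> {..<n}" "T' \<subseteq> {..<n} - S'"
    and eq: "cyc (2 * l) (\<lambda>j. vec n (zigzag l a T j)) = cyc (2 * l) (\<lambda>j. vec n (zigzag l a' T' j))"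
  shows "S = S' \<and> T = T'"
proof -
  have "vec n ` (zigzag l a T ` {..<2 * l}) = vec n ` (zigzag l a' T' ` {..<2 * l})"
    using arg_cong[OF eq, of verts] by (simp add: image_image)
  moreover have "inj_on (vec n) (Pow {..<n})"
    by (auto simp: inj_on_def tr_eq_iff)
  moreover have "zigzag l a T ` {..<2 * l} \<subseteq> Pow {..<n}" "zigzag l a' T' ` {..<2 * l} \<subseteq> Pow {..<n}"
  proof -
    have "a ` {..<l} \<subseteq> {..<n}" "T \<subseteq> {..<n}" "a' ` {..<l} \<subseteq> {..<n}" "T' \<subseteq> {..<n}"
      using a a' S S' by (auto simp: bij_betw_def)
    then show "zigzag l a T ` {..<2 * l} \<subseteq> Pow {..<n}" "zigzag l a' T' ` {..<2 * l} \<subseteq> Pow {..<n}"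
      using zigzag_subset[of a l n T] zigzag_subset[of a' l n T'] by (simp_all add: image_subset_iff)
  qed
  ultimately have 1: "zigzag l a T ` {..<2 * l} = zigzag l a' T' ` {..<2 * l}"
    by (simp add: inj_on_image_eq_iff)
  then have "\<Inter> (zigzag l a T ` {..<2 * l}) = \<Inter> (zigzag l a' T' ` {..<2 * l})"
    by simp
  then have T: "T = T'"
    by (simp add: Inter_zigzag[OF a l] Inter_zigzag[OF a' l])
  have "\<Union> (zigzag l a T ` {..<2 * l}) = \<Union> (zigzag l a' T' ` {..<2 * l})"
    using 1 by simp
  then have "S \<union> T = S' \<union> T'"
    by (simp add: Union_zigzag[OF a l] Union_zigzag[OF a' l])
  with T S S' show ?thesis by auto
qed

text \<open>Conditions on the parameters under which the zigzag cycle survives. Its lower vertices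
  have size \<open>card T + 1\<close>, which dictates \<open>r\<close>; on \<open>S\<close>,
  \<open>C\<close> is chosen to offset the contribution of \<open>T\<close> to the parity at
  \<open>a i\<close>.\<close>

definition fits :: "nat \<Rightarrow> (nat \<Rightarrow> nat) \<Rightarrow> nat set \<Rightarrow> nat set \<Rightarrow> nat set \<Rightarrow> bool \<times> nat set \<times> nat set \<Rightarrow> bool" where
  "fits l a P S T = (\<lambda>(r, B, C). r = even (card T) \<and> B \<inter> S = P \<and>
     C \<inter> S = a ` {i. i < l \<and> odd (card {u \<in> T. above B (a i) u}) \<noteq> odd i})"

text \<open>The element \<open>a i\<close> is added to exactly two lower vertices, \<open>T\<close>
  plus its predecessor and \<open>T\<close> plus its successor. It sees both with value
  \<open>odd i\<close>, so one bit of \<open>C\<close> serves both arcs.\<close>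

lemma cycle_in_arc_graph:
  assumes a: "bij_betw a {..<l} S" and l: "3 \<le> l" and S: "S \<subseteq> {..<n}" "T \<subseteq> {..<n} - S"
    and P: "\<And>i. i < l \<Longrightarrow> above P (a i) (a (Suc i mod l)) = odd i \<and>
      above P (a (Suc i mod l)) (a i) = odd (Suc i mod l)"
    and fits: "fits l a P S T (r, B, C)"
  shows "cycle_in (arc_graph n r B C) (2 * l) (\<lambda>j. vec n (zigzag l a T j))"
proof -
  have finT: "finite T"
    using S finite_subset by blast
  have aS: "a i \<in> S" if "i < l" for i
    using a that by (auto simp: bij_betw_def)
  have inj: "a i = a i' \<longleftrightarrow> i = i'" if "i < l" "i' < l" for i i'
    using a that by (auto simp: bij_betw_def inj_on_def)
  have r: "r = even (card T)"
    using fits by (simp add: fits_def)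
  have C: "a i \<in> C \<longleftrightarrow> odd (card {u \<in> T. above B (a i) u}) \<noteq> odd i" if "i < l" for i
  proof -
    have "a i \<in> C \<longleftrightarrow> a i \<in> C \<inter> S"
      using aS[OF that] by simp
    also have "C \<inter> S = a ` {i. i < l \<and> odd (card {u \<in> T. above B (a i) u}) \<noteq> odd i}"
      using fits by (simp add: fits_def)
    also have "a i \<in> \<dots> \<longleftrightarrow> odd (card {u \<in> T. above B (a i) u}) \<noteq> odd i"
      using that inj by auto
    finally show ?thesis .
  qed
  have B: "above B (a i) (a (Suc i mod l)) = odd i"
    "above B (a (Suc i mod l)) (a i) = odd (Suc i mod l)" if "i < l" for i
  proof -
    have "Suc i mod l < l"
      using that by simp
    moreover have "B \<inter> S = P"
      using fits by (simp add: fits_def)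
    ultimately show "above B (a i) (a (Suc i mod l)) = odd i"
      "above B (a (Suc i mod l)) (a i) = odd (Suc i mod l)"
      using P[OF that] aS that by (metis above_Int)+
  qed
  have arc: "up_arc r B C (insert (a i) T) (a k)"
    if ik: "i < l" "k < l" "i \<noteq> k" and "above B (a k) (a i) = odd k" for i k
  proof -
    have "a i \<notin> T" "a k \<notin> T"
      using aS S ik by auto
    moreover have "odd (card {u \<in> insert (a i) T. above B (a k) u}) = (a k \<in> C)"
      unfolding odd_card_insert[OF finT \<open>a i \<notin> T\<close>] C[OF ik(2)] that(4) by auto
    ultimately show ?thesis
      using finT inj ik unfolding up_arc_def by (simp add: r)
  qed
  have edge: "{vec n A, vec n (insert x A)} \<in> edges (arc_graph n r B C)"
    if "A \<subseteq> {..<n}" "x < n" "up_arc r B C A x" for A x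
    using that by (auto simp: arc_graph_def)
  have sub: "insert (a i) T \<subseteq> {..<n}" "a i < n" if "i < l" for i
    using aS[OF that] S by auto
  have "{vec n (zigzag l a T j), vec n (zigzag l a T (Suc j mod (2 * l)))} \<in> edges (arc_graph n r B C)"
    if j: "j < 2 * l" for j
  proof -
    define i where "i = j div 2"
    have i: "i < l" "Suc i mod l < l" "Suc i mod l \<noteq> i"
      using j l Suc_mod_neq[of l i] by (auto simp: i_def)
    show ?thesis
    proof (cases "even j")
      case True
      then have "Suc j mod (2 * l) = Suc j" "Suc j div 2 = i" "odd (Suc j)"
        using j by (auto simp: i_def mod_less elim!: evenE)
      then have Z: "zigzag l a T j = insert (a i) T"
        "zigzag l a T (Suc j mod (2 * l)) = insert (a (Suc i mod l)) (insert (a i) T)"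
        using True by (simp_all add: zigzag_def i_def)
      show ?thesis
        unfolding Z using edge[OF sub(1)[OF i(1)] sub(2)[OF i(2)] arc[OF i(1,2)]] B(2)[OF i(1)] i(3)
        by metis
    next
      \<comment> \<open>From an odd position the cycle descends: the arc starts at the next vertex
        and adds \<open>a i\<close>.\<close>
      case False
      have "even (Suc j mod (2 * l))" "(Suc j mod (2 * l)) div 2 = Suc i mod l"
        using False j by (auto simp: i_def mod_Suc elim!: oddE)
      then have Z: "zigzag l a T j = insert (a i) (insert (a (Suc i mod l)) T)"
        "zigzag l a T (Suc j mod (2 * l)) = insert (a (Suc i mod l)) T"
        using False by (auto simp: zigzag_def i_def)
      show ?thesis
        unfolding Z using edge[OF sub(1)[OF i(2)] sub(2)[OF i(1)] arc[OF i(2,1)]] B(1)[OF i(1)] i(3)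
        by (metis insert_commute)
    qed
  qed
  moreover have "inj_on (\<lambda>j. vec n (zigzag l a T j)) {..<2 * l}"
  proof -
    have "T \<inter> S = {}"
      using S by auto
    have sub: "zigzag l a T j \<subseteq> {..<n}" if "j < 2 * l" for j
      by (rule zigzag_subset[OF _ _ that]) (use a S in \<open>auto simp: bij_betw_def\<close>)
    show ?thesis
      using zigzag_inj[OF a l \<open>T \<inter> S = {}\<close> finT] sub by (auto simp: inj_on_def tr_eq_iff)
  qed
  ultimately show ?thesis
    unfolding cycle_in_def by blast
qed

section \<open>Averaging over the parameters\<close>

lemma card_Int_eq:
  assumes "finite U" "P \<subseteq> S" "S \<subseteq> U"
  shows "card {B \<in> Pow U. B \<inter> S = P} = 2 ^ (card U - card S)"
proof -
  have "{B \<in> Pow U. B \<inter> S = P} = (\<lambda>A. A \<union> P) ` Pow (U - S)"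
  proof
    show "{B \<in> Pow U. B \<inter> S = P} \<subseteq> (\<lambda>A. A \<union> P) ` Pow (U - S)"
    proof
      fix B assume B: "B \<in> {B \<in> Pow U. B \<inter> S = P}"
      then have "B = (B - S) \<union> P" by auto
      then show "B \<in> (\<lambda>A. A \<union> P) ` Pow (U - S)"
        using B by blast
    qed
  qed (use assms in auto)
  moreover have "inj_on (\<lambda>A. A \<union> P) (Pow (U - S))"
    using assms by (auto simp: inj_on_def)
  ultimately show ?thesis
    using assms by (simp add: card_image card_Pow card_Diff_subset finite_subset)
qed

text \<open>\<open>r\<close> is forced and \<open>B\<close> is free outside \<open>S\<close>. What
  \<open>C\<close> has to be on \<open>S\<close> depends on all of \<open>B\<close>, but for each
  \<open>B\<close> there remain \<open>2 ^ (n - l)\<close> choices, hence the dependent sum.\<close>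

lemma card_fits:
  assumes a: "bij_betw a {..<l} S" and S: "S \<subseteq> {..<n}" "P \<subseteq> S" and l: "card S = l"
  shows "card {q \<in> UNIV \<times> Pow {..<n} \<times> Pow {..<n}. fits l a P S T q} = 4 ^ (n - l)"
proof -
  let ?R = "\<lambda>B. a ` {i. i < l \<and> odd (card {u \<in> T. above B (a i) u}) \<noteq> odd i}"
  have R: "?R B \<subseteq> S" for B
    using a by (auto simp: bij_betw_def)
  have "{q \<in> UNIV \<times> Pow {..<n} \<times> Pow {..<n}. fits l a P S T q} =
      {even (card T)} \<times> (SIGMA B:{B \<in> Pow {..<n}. B \<inter> S = P}. {C \<in> Pow {..<n}. C \<inter> S = ?R B})"
    by (auto simp: fits_def)
  then show ?thesis
    using card_Int_eq[of "{..<n}" _ S] S R l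
    by (simp add: card_cartesian_product card_SigmaI flip: power_mult_distrib)
qed

lemma card_subset_pairs:
  "card (SIGMA S:{S. S \<subseteq> {..<n} \<and> card S = l}. Pow ({..<n} - S)) = (n choose l) * 2 ^ (n - l)"
proof -
  have "card (Pow ({..<n} - S)) = 2 ^ (n - l)" if "S \<in> {S. S \<subseteq> {..<n} \<and> card S = l}" for S
    using that by (auto simp: card_Pow card_Diff_subset finite_subset)
  moreover have "finite {S. S \<subseteq> {..<n} \<and> card S = l}"
    by (rule finite_subset[of _ "Pow {..<n}"]) auto
  ultimately show ?thesis
    using n_subsets[of "{..<n}" l] by (simp add: card_SigmaI)
qed

lemma num_copies_le_ex_copies:
  assumes "simple_graph G" "subgraph G' G" "free_of G' H"
  shows "num_copies G' T \<le> ex_copies G T H"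
  unfolding ex_copies_def
proof (rule Max_ge)
  show "finite {num_copies G' T | G'. subgraph G' G \<and> free_of G' H}"
    by (rule finite_subset[OF _ finite_imageI[OF finite_subgraphs[OF assms(1)], of "\<lambda>K. num_copies K T"]]) blast
qed (use assms in blast)

text \<open>Pairs \<open>(S, T)\<close> are counted against parameters. For fixed parameters the
  fitting pairs give distinct copies in a hexagon-free graph, so at most \<open>?ex\<close> of them
  fit; each pair fits \<open>4 ^ (n - l)\<close> of the \<open>2 * 4 ^ n\<close> parameters.\<close>

lemma ex_copies_lower:
  assumes l: "4 \<le> l" "l \<le> n"
  shows "(n choose l) * 2 ^ (n - l) \<le> ex_copies (hypercube n) (cycle (2 * l)) (cycle 6) * 4 ^ (l + 1)"
proof -
  let ?U = "{..<n}"
  let ?SS = "{S. S \<subseteq> ?U \<and> card S = l}"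
  let ?Q = "SIGMA S:?SS. Pow (?U - S)"
  let ?Par = "(UNIV :: bool set) \<times> Pow ?U \<times> Pow ?U"
  let ?ex = "ex_copies (hypercube n) (cycle (2 * l)) (cycle 6)"
  define alt where "alt S P a \<longleftrightarrow> P \<subseteq> S \<and> bij_betw a {..<l} S \<and>
    (\<forall>i<l. above P (a i) (a (Suc i mod l)) = odd i \<and> above P (a (Suc i mod l)) (a i) = odd (Suc i mod l))"
    for S P a
  have "\<exists>P a. alt S P a" if "S \<in> ?SS" for S
  proof -
    have "finite S" "card S = l"
      using that finite_subset by auto
    then show ?thesis
      by (rule alternating_order[OF _ _ l(1)]) (auto simp: alt_def)
  qed
  \<comment> \<open>One pattern is fixed per \<open>S\<close>, independently of \<open>T\<close> and
    of the parameters.\<close>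
  then obtain P a where alt: "\<And>S. S \<in> ?SS \<Longrightarrow> alt S (P S) (a S)"
    by metis
  have Pa: "P S \<subseteq> S" "bij_betw (a S) {..<l} S"
    "\<And>i. i < l \<Longrightarrow> above (P S) (a S i) (a S (Suc i mod l)) = odd i \<and>
      above (P S) (a S (Suc i mod l)) (a S i) = odd (Suc i mod l)" if "S \<in> ?SS" for S
    using alt[OF that] unfolding alt_def by blast+
  let ?fits = "\<lambda>\<pi> (S, T). fits l (a S) (P S) S T \<pi>"
  let ?K = "\<lambda>(S, T). cyc (2 * l) (\<lambda>j. vec n (zigzag l (a S) T j))"
  have finQ: "finite ?Q"
  proof (rule finite_SigmaI)
    show "finite ?SS"
      by (rule finite_subset[of _ "Pow ?U"]) auto
  qed auto
  have l3: "3 \<le> l"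
    using l by simp
  have le_ex: "card {q \<in> ?Q. ?fits \<pi> q} \<le> ?ex" for \<pi>
  proof -
    obtain r B C where \<pi>: "\<pi> = (r, B, C)"
      using prod_cases3 by blast
    let ?G = "arc_graph n r B C"
    have G: "simple_graph ?G"
      using subgraph_arc_graph[of n r B C] by (simp add: subgraph_def)
    have "inj_on ?K {q \<in> ?Q. ?fits \<pi> q}"
    proof (rule inj_onI)
      fix q q' assume q: "q \<in> {q \<in> ?Q. ?fits \<pi> q}" and q': "q' \<in> {q \<in> ?Q. ?fits \<pi> q}"
        and eq: "?K q = ?K q'"
      obtain S T S' T' where ST: "q = (S, T)" "q' = (S', T')"
        by fastforce
      have "S \<in> ?SS" "T \<subseteq> ?U - S" "S' \<in> ?SS" "T' \<subseteq> ?U - S'"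
        using q q' ST by auto
      then show "q = q'"
        using zigzag_cyc_inj[OF Pa(2) Pa(2) l3, of S S' n T T'] eq ST by auto
    qed
    moreover have "?K ` {q \<in> ?Q. ?fits \<pi> q} \<subseteq> copies ?G (cycle (2 * l))"
    proof (rule image_subsetI)
      fix q assume q: "q \<in> {q \<in> ?Q. ?fits \<pi> q}"
      obtain S T where ST: "q = (S, T)"
        by fastforce
      have S: "S \<in> ?SS" "S \<subseteq> ?U" "T \<subseteq> ?U - S" and fits: "fits l (a S) (P S) S T (r, B, C)"
        using q ST \<pi> by auto
      have "cycle_in ?G (2 * l) (\<lambda>j. vec n (zigzag l (a S) T j))"
        by (rule cycle_in_arc_graph[OF Pa(2)[OF S(1)] l3 S(2,3) Pa(3)[OF S(1)] fits])
      then show "?K q \<in> copies ?G (cycle (2 * l))"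
        using copies_cycle[OF G, of "2 * l"] l ST by auto
    qed
    ultimately have "card {q \<in> ?Q. ?fits \<pi> q} \<le> num_copies ?G (cycle (2 * l))"
      unfolding num_copies_def using finite_copies[OF G] by (rule card_inj_on_le)
    also have "\<dots> \<le> ?ex"
      using arc_graph_hexagon_free free_of_cycle[OF G, of 6]
      by (intro num_copies_le_ex_copies simple_graph_hypercube subgraph_arc_graph) auto
    finally show ?thesis .
  qed
  have "(n choose l) * 2 ^ (n - l) * 4 ^ (n - l) = (\<Sum>q\<in>?Q. 4 ^ (n - l))"
    by (simp add: card_subset_pairs)
  also have "\<dots> = (\<Sum>q\<in>?Q. card {\<pi> \<in> ?Par. ?fits \<pi> q})"
  proof (rule sum.cong)
    fix q assume q: "q \<in> ?Q"
    obtain S T where ST: "q = (S, T)"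
      by fastforce
    have S: "S \<in> ?SS" "S \<subseteq> ?U" "card S = l"
      using q ST by auto
    show "4 ^ (n - l) = card {\<pi> \<in> ?Par. ?fits \<pi> q}"
      using card_fits[OF Pa(2)[OF S(1)] S(2) Pa(1)[OF S(1)] S(3), of T] by (simp add: ST)
  qed simp
  also have "\<dots> = (\<Sum>\<pi>\<in>?Par. card {q \<in> ?Q. ?fits \<pi> q})"
    by (rule sum_card_swap[OF _ finQ, symmetric]) simp
  also have "\<dots> \<le> (\<Sum>\<pi>\<in>?Par. ?ex)"
    by (intro sum_mono le_ex)
  also have "\<dots> = ?ex * (2 * 4 ^ n)"
    by (simp add: card_cartesian_product card_Pow flip: power_mult_distrib)
  also have "(4::nat) ^ n = 4 ^ l * 4 ^ (n - l)"
    using l by (simp flip: power_add)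
  finally have "(n choose l) * 2 ^ (n - l) \<le> ?ex * (2 * 4 ^ l)"
    by simp
  \<comment> \<open>The averaging constant is half of the stated one.\<close>
  also have "\<dots> \<le> ?ex * 4 ^ (l + 1)"
    by (intro mult_left_mono) auto
  finally show ?thesis .
qed

section \<open>Counting cycles in the hypercube\<close>

lemma odd_card_changes:
  fixes h :: "nat \<Rightarrow> bool"
  shows "odd (card {i. i < m \<and> h i \<noteq> h (Suc i)}) \<longleftrightarrow> h 0 \<noteq> h m"
proof (induction m)
  case (Suc m)
  have "{i. i < Suc m \<and> h i \<noteq> h (Suc i)} =
      (if h m \<noteq> h (Suc m) then insert m {i. i < m \<and> h i \<noteq> h (Suc i)} else {i. i < m \<and> h i \<noteq> h (Suc i)})"
    by (auto simp: less_Suc_eq)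
  with Suc show ?case by auto
qed simp

definition step :: "nat \<Rightarrow> (nat \<Rightarrow> bool list) \<Rightarrow> nat \<Rightarrow> nat" where
  "step m g i = flip_coord {g i, g (Suc i mod m)}"

lemma step:
  assumes "cycle_in (hypercube n) m g" "i < m"
  shows "step m g i < n" "g (Suc i mod m) = tr (g i) {step m g i}"
proof -
  have "{g i, g (Suc i mod m)} \<in> edges (hypercube n)"
    using assms by (simp add: cycle_in_def)
  then obtain k where k: "k < n" "g (Suc i mod m) = tr (g i) {k}" "length (g i) = n"
    unfolding hypercube_edge_iff by blast
  then have "step m g i = k"
    unfolding step_def by (simp add: flip_coord_tr)
  with k show "step m g i < n" "g (Suc i mod m) = tr (g i) {step m g i}" by simp_all
qed

lemma flip_coord_edges_cyc: "flip_coord ` edges (cyc m g) = step m g ` {..<m}"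
  unfolding edges_cyc step_def by (simp add: image_image)

text \<open>Coordinate \<open>k\<close> returns to its initial value after a full turn.\<close>

lemma even_card_step:
  assumes g: "cycle_in (hypercube n) m g" and k: "k < n"
  shows "even (card {i. i < m \<and> step m g i = k})"
proof -
  \<comment> \<open>The index \<open>i mod m\<close> makes the sequence return to \<open>g 0\<close>
    at \<open>m\<close>, as \<open>odd_card_changes\<close> needs.\<close>
  have eq: "(g (i mod m) ! k \<noteq> g (Suc i mod m) ! k) = (step m g i = k)" if "i < m" for i
    using step[OF g that] cycle_in_length[OF g that] k that by auto
  have "{i. i < m \<and> step m g i = k} = {i. i < m \<and> g (i mod m) ! k \<noteq> g (Suc i mod m) ! k}"
    by (intro Collect_cong conj_cong refl eq[symmetric])
  then show ?thesis
    using odd_card_changes[of m "\<lambda>i. g (i mod m) ! k"] by simp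
qed

text \<open>Every direction that occurs is used a positive even number of times, hence at least
  twice.\<close>

lemma card_flip_coord_le:
  assumes g: "cycle_in (hypercube n) m g"
  shows "2 * card (step m g ` {..<m}) \<le> m"
proof -
  have "2 * card (step m g ` {..<m}) = (\<Sum>k\<in>step m g ` {..<m}. 2)"
    by simp
  also have "\<dots> \<le> (\<Sum>k\<in>step m g ` {..<m}. card {i \<in> {..<m}. step m g i = k})"
  proof (rule sum_mono)
    fix k assume "k \<in> step m g ` {..<m}"
    then obtain i where i: "i < m" "k = step m g i" by auto
    have "even (card {i. i < m \<and> step m g i = k})"
      using even_card_step[OF g] step(1)[OF g i(1)] i(2) by blast
    moreover have "{i. i < m \<and> step m g i = k} \<noteq> {}"
      using i by auto
    then have "0 < card {i. i < m \<and> step m g i = k}"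
      by (simp add: card_gt_0_iff)
    ultimately show "2 \<le> card {i \<in> {..<m}. step m g i = k}"
      by (simp only: lessThan_iff) (rule dvd_imp_le)
  qed
  also have "\<dots> = m"
    using sum.image_gen[of "{..<m}" "\<lambda>_. 1::nat" "step m g"] by simp
  finally show ?thesis .
qed

text \<open>Such a list is coded by \<open>k\<close> values and a word of \<open>m\<close> indices
  into them.\<close>

lemma card_lists_few_values:
  assumes "1 \<le> n"
  shows "card {ds. set ds \<subseteq> {..<n} \<and> length ds = m \<and> card (set ds) \<le> k} \<le> n ^ k * k ^ m"
proof -
  let ?A = "{us. set us \<subseteq> {..<n} \<and> length us = k}" and ?B = "{is. set is \<subseteq> {..<k} \<and> length is = m}"
  have sub: "{ds. set ds \<subseteq> {..<n} \<and> length ds = m \<and> card (set ds) \<le> k}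
    \<subseteq> (\<lambda>(us, is). map ((!) us) is) ` (?A \<times> ?B)"
  proof
    fix ds assume "ds \<in> {ds. set ds \<subseteq> {..<n} \<and> length ds = m \<and> card (set ds) \<le> k}"
    then have ds: "set ds \<subseteq> {..<n}" "length ds = m" "card (set ds) \<le> k" by auto
    let ?xs = "sorted_list_of_set (set ds)"
    \<comment> \<open>Padding to length exactly \<open>k\<close>; the filler 0 is an admissible
      value because \<open>n >= 1\<close>.\<close>
    define us where "us = ?xs @ replicate (k - length ?xs) 0"
    have us: "us \<in> ?A"
      using ds assms by (auto simp: us_def)
    have "\<exists>i<k. us ! i = d" if "d \<in> set ds" for d
    proof -
      have "d \<in> set us"
        using that by (simp add: us_def)
      then show ?thesis
        using us by (auto simp: in_set_conv_nth)
    qed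
    then obtain idx where idx: "\<And>d. d \<in> set ds \<Longrightarrow> idx d < k \<and> us ! idx d = d"
      by metis
    then have "map ((!) us) (map idx ds) = ds"
      by (simp add: map_idI)
    moreover have "map idx ds \<in> ?B"
      using idx ds by auto
    ultimately show "ds \<in> (\<lambda>(us, is). map ((!) us) is) ` (?A \<times> ?B)"
      using us by (intro image_eqI[of _ _ "(us, map idx ds)"]) auto
  qed
  have fin: "finite ?A" "finite ?B"
    by (simp_all add: finite_lists_length_eq)
  have "card {ds. set ds \<subseteq> {..<n} \<and> length ds = m \<and> card (set ds) \<le> k}
      \<le> card ((\<lambda>(us, is). map ((!) us) is) ` (?A \<times> ?B))"
    using sub fin by (intro card_mono) auto
  also have "\<dots> \<le> card (?A \<times> ?B)"
    using fin by (intro card_image_le) auto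
  also have "\<dots> = n ^ k * k ^ m"
    by (simp add: card_cartesian_product card_lists_length_eq)
  finally show ?thesis .
qed

definition walk :: "bool list \<Rightarrow> nat list \<Rightarrow> nat \<Rightarrow> bool list" where
  "walk x ds j = foldl (\<lambda>y d. tr y {d}) x (take j ds)"

lemma walk_step:
  assumes g: "cycle_in (hypercube n) m g" and j: "j < m"
  shows "walk (g 0) (map (step m g) [0..<m]) j = g j"
  using j
proof (induction j)
  case (Suc j)
  then have "walk (g 0) (map (step m g) [0..<m]) (Suc j) = tr (g j) {step m g j}"
    by (simp add: walk_def take_Suc_conv_app_nth)
  also have "\<dots> = g (Suc j)"
    using step(2)[OF g, of j] Suc.prems by simp
  finally show ?case .
qed (simp add: walk_def)

section \<open>Copies sorted by the number of their directions\<close>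

text \<open>A cycle is recovered from its start vertex and its sequence of directions. With
  \<open>k = l - 1\<close> this bounds the copies of lower order in \<open>n\<close>.\<close>

lemma card_copies_few_coords:
  assumes n: "1 \<le> n" and m: "2 \<le> m"
  shows "card {K \<in> copies (hypercube n) (cycle m). card (flip_coord ` edges K) \<le> k} \<le> 2 ^ n * (n ^ k * k ^ m)"
proof -
  let ?V = "{x :: bool list. length x = n}"
  let ?D = "{ds. set ds \<subseteq> {..<n} \<and> length ds = m \<and> card (set ds) \<le> k}"
  have fin: "finite (?V \<times> ?D)"
  proof -
    have "finite ?V"
      using finite_lists_length_eq[of "UNIV :: bool set" n] by simp
    moreover have "finite ?D"
      by (rule finite_subset[OF _ finite_lists_length_eq[of "{..<n}" m]]) auto
    ultimately show ?thesis by simp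
  qed
  have "{K \<in> copies (hypercube n) (cycle m). card (flip_coord ` edges K) \<le> k}
      \<subseteq> (\<lambda>(x, ds). cyc m (walk x ds)) ` (?V \<times> ?D)"
  proof
    fix K assume K: "K \<in> {K \<in> copies (hypercube n) (cycle m). card (flip_coord ` edges K) \<le> k}"
    then obtain g where g: "cycle_in (hypercube n) m g" "K = cyc m g"
      using copies_cycle[OF simple_graph_hypercube m] by auto
    let ?ds = "map (step m g) [0..<m]"
    have "cyc m (walk (g 0) ?ds) = K"
      unfolding g(2) by (rule cyc_cong) (rule walk_step[OF g(1)])
    moreover have "g 0 \<in> ?V"
      using cycle_in_length[OF g(1), of 0] m by simp
    moreover have "card (set ?ds) \<le> k"
      using K by (simp add: g(2) flip_coord_edges_cyc lessThan_atLeast0)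
    then have "?ds \<in> ?D"
      using step(1)[OF g(1)] by auto
    ultimately show "K \<in> (\<lambda>(x, ds). cyc m (walk x ds)) ` (?V \<times> ?D)"
      by (intro image_eqI[of _ _ "(g 0, ?ds)"]) auto
  qed
  then have "card {K \<in> copies (hypercube n) (cycle m). card (flip_coord ` edges K) \<le> k}
      \<le> card ((\<lambda>(x, ds). cyc m (walk x ds)) ` (?V \<times> ?D))"
    using fin by (intro card_mono) auto
  also have "\<dots> \<le> card (?V \<times> ?D)"
    using fin by (rule card_image_le)
  also have "\<dots> \<le> 2 ^ n * (n ^ k * k ^ m)"
    unfolding card_cartesian_product card_verts_hypercube
    using card_lists_few_values[OF n] by (rule mult_left_mono) simp
  finally show ?thesis .
qed

text \<open>For \<open>T\<close> disjoint from \<open>S\<close> and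
  \<open>card S = length x\<close>, this embeds a small cube as the subcube with free coordinates
  \<open>S\<close>, in increasing order, whose fixed coordinates are 1 exactly on
  \<open>T\<close>.\<close>

definition lift :: "nat \<Rightarrow> nat set \<Rightarrow> nat set \<Rightarrow> bool list \<Rightarrow> bool list" where
  "lift n S T x = vec n (T \<union> (!) (sorted_list_of_set S) ` {i. i < length x \<and> x ! i})"

text \<open>A cycle with direction set \<open>S\<close> is constant outside \<open>S\<close>, so it
  lies in one subcube. Its restriction to \<open>S\<close> uses all \<open>l\<close> coordinates and
  is counted by \<open>z l l\<close>, and lifting recovers the cycle.\<close>

lemma card_copies_l_coords:
  assumes l: "1 \<le> l"
  shows "card {K \<in> copies (hypercube n) (cycle (2 * l)). card (flip_coord ` edges K) = l}
    \<le> (n choose l) * 2 ^ (n - l) * z l l"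
proof -
  let ?Q = "SIGMA S:{S. S \<subseteq> {..<n} \<and> card S = l}. Pow ({..<n} - S)"
  let ?Z = "{K \<in> copies (hypercube l) (cycle (2 * l)). flip_coord ` edges K = {..<l}}"
  have finQ: "finite ?Q"
  proof (rule finite_SigmaI)
    show "finite {S. S \<subseteq> {..<n} \<and> card S = l}"
      by (rule finite_subset[of _ "Pow {..<n}"]) auto
  qed auto
  have finZ: "finite ?Z"
    by (rule finite_subset[OF _ finite_copies[OF simple_graph_hypercube]]) auto
  have "{K \<in> copies (hypercube n) (cycle (2 * l)). card (flip_coord ` edges K) = l}
      \<subseteq> (\<lambda>((S, T), K). map_graph (lift n S T) K) ` (?Q \<times> ?Z)"
  proof
    fix K assume K: "K \<in> {K \<in> copies (hypercube n) (cycle (2 * l)). card (flip_coord ` edges K) = l}"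
    then obtain g where g: "cycle_in (hypercube n) (2 * l) g" "K = cyc (2 * l) g"
      using copies_cycle[OF simple_graph_hypercube, of "2 * l" n] l by auto
    let ?m = "2 * l"
    define S where "S = step ?m g ` {..<?m}"
    define T where "T = {k \<in> {..<n} - S. g 0 ! k}"
    have finS: "finite S"
      by (simp add: S_def)
    have S: "S \<subseteq> {..<n}" "card S = l"
      using K step(1)[OF g(1)] by (auto simp: S_def g(2) flip_coord_edges_cyc)
    let ?s = "(!) (sorted_list_of_set S)"
    have s: "bij_betw ?s {..<l} S"
      using finS S by (intro bij_betw_nth) auto
    define res where "res x = map (\<lambda>i. x ! ?s i) [0..<l]" for x :: "bool list"
    have len_res: "length (res x) = l" for x
      by (simp add: res_def)
    have sn: "?s i < n" "?s i \<in> S" if "i < l" for i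
      using that s S by (auto simp: bij_betw_def)
    have s_inj: "?s i = ?s j \<longleftrightarrow> i = j" if "i < l" "j < l" for i j
      using that s by (auto simp: bij_betw_def inj_on_def)
    have out: "g j ! k = g 0 ! k" if "j < ?m" "k \<in> {..<n} - S" for j k
      using that(1)
    proof (induction j)
      case (Suc j)
      have "g (Suc j) = tr (g j) {step ?m g j}"
        using step(2)[OF g(1), of j] Suc.prems by simp
      moreover have "k \<noteq> step ?m g j"
        using Suc.prems that by (auto simp: S_def)
      moreover have "length (g j) = n"
        using cycle_in_length[OF g(1)] Suc.prems by simp
      ultimately show ?case
        using Suc that by simp
    qed simp
    have lift_res: "lift n S T (res (g j)) = g j" if j: "j < ?m" for j
    proof (rule nth_equalityI)
      show "length (lift n S T (res (g j))) = length (g j)"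
        using cycle_in_length[OF g(1) j] by (simp add: lift_def)
      fix k assume "k < length (lift n S T (res (g j)))"
      then have k: "k < n"
        by (simp add: lift_def)
      have "lift n S T (res (g j)) ! k \<longleftrightarrow> k \<in> T \<or> (\<exists>i<l. k = ?s i \<and> g j ! k)"
        using k by (auto simp: lift_def res_def)
      also have "\<dots> \<longleftrightarrow> g j ! k"
      proof (cases "k \<in> S")
        case True
        then obtain i where "i < l" "k = ?s i"
          using s by (auto simp: bij_betw_def)
        then show ?thesis
          using True by (auto simp: T_def)
      next
        case False
        then have "\<not> (\<exists>i<l. k = ?s i)"
          using sn by auto
        then show ?thesis
          using False k out[OF j, of k] by (auto simp: T_def)
      qed
      finally show "lift n S T (res (g j)) ! k = g j ! k" .
    qed
    have res_tr: "res (tr x {?s i}) = tr (res x) {i}" if "length x = n" "i < l" for x i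
      using that sn s_inj by (auto simp: res_def list_eq_iff_nth_eq)
    have step_res: "\<exists>i<l. step ?m g j = ?s i \<and> res (g (Suc j mod ?m)) = tr (res (g j)) {i}" if j: "j < ?m" for j
    proof -
      have "step ?m g j \<in> S"
        using j by (auto simp: S_def)
      then obtain i where i: "i < l" "step ?m g j = ?s i"
        using s by (auto simp: bij_betw_def)
      have "res (g (Suc j mod ?m)) = tr (res (g j)) {i}"
        unfolding step(2)[OF g(1) j] i(2) by (rule res_tr[OF cycle_in_length[OF g(1) j] i(1)])
      with i show ?thesis by blast
    qed
    have K': "cycle_in (hypercube l) ?m (res \<circ> g)"
    proof -
      have "inj_on (res \<circ> g) {..<?m}"
      proof (rule inj_onI)
        fix i j assume ij: "i \<in> {..<?m}" "j \<in> {..<?m}" "(res \<circ> g) i = (res \<circ> g) j"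
        have "g i = lift n S T (res (g i))" "g j = lift n S T (res (g j))"
          using lift_res ij(1,2) by simp_all
        then have "g i = g j"
          using ij(3) by (metis comp_apply)
        then show "i = j"
          using g(1) ij(1,2) unfolding cycle_in_def by (metis inj_onD)
      qed
      moreover have "{res (g j), res (g (Suc j mod ?m))} \<in> edges (hypercube l)" if "j < ?m" for j
        unfolding hypercube_edge_iff using step_res[OF that] len_res by blast
      ultimately show ?thesis
        by (simp add: cycle_in_def)
    qed
    have "step ?m (res \<circ> g) ` {..<?m} = {..<l}"
    proof
      show "step ?m (res \<circ> g) ` {..<?m} \<subseteq> {..<l}"
        using step(1)[OF K'] by auto
      show "{..<l} \<subseteq> step ?m (res \<circ> g) ` {..<?m}"
      proof
        fix i assume i: "i \<in> {..<l}"
        then have "?s i \<in> S"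
          using sn by auto
        then obtain j where j: "j < ?m" "step ?m g j = ?s i"
          unfolding S_def by auto
        then obtain i' where "i' < l" "?s i = ?s i'" "res (g (Suc j mod ?m)) = tr (res (g j)) {i'}"
          using step_res by metis
        then have "step ?m (res \<circ> g) j = i"
          using i s_inj[of i i'] len_res by (simp add: step_def flip_coord_tr)
        then show "i \<in> step ?m (res \<circ> g) ` {..<?m}"
          using j by blast
      qed
    qed
    then have "cyc ?m (res \<circ> g) \<in> ?Z"
      using K' copies_cycle[OF simple_graph_hypercube, of ?m l] l by (auto simp: flip_coord_edges_cyc)
    moreover have "(S, T) \<in> ?Q"
      using S by (auto simp: T_def)
    moreover have "map_graph (lift n S T) (cyc ?m (res \<circ> g)) = K"
      unfolding map_graph_cyc g(2) by (rule cyc_cong) (simp add: lift_res)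
    ultimately show "K \<in> (\<lambda>((S, T), K). map_graph (lift n S T) K) ` (?Q \<times> ?Z)"
      by (intro image_eqI[of _ _ "((S, T), cyc ?m (res \<circ> g))"]) auto
  qed
  then have "card {K \<in> copies (hypercube n) (cycle (2 * l)). card (flip_coord ` edges K) = l}
      \<le> card ((\<lambda>((S, T), K). map_graph (lift n S T) K) ` (?Q \<times> ?Z))"
    using finQ finZ by (intro card_mono) auto
  also have "\<dots> \<le> card (?Q \<times> ?Z)"
    using finQ finZ by (intro card_image_le) auto
  also have "\<dots> = (n choose l) * 2 ^ (n - l) * z l l"
    by (simp only: card_cartesian_product card_subset_pairs z_def)
  finally show ?thesis .
qed

text \<open>At most \<open>l\<close> directions occur; exactly \<open>l\<close> gives the main term
  and fewer give the error term.\<close>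

lemma num_copies_hypercube_le:
  assumes l: "1 \<le> l" and n: "1 \<le> n"
  shows "num_copies (hypercube n) (cycle (2 * l))
    \<le> (n choose l) * 2 ^ (n - l) * z l l + 2 ^ n * (n ^ (l - 1) * (l - 1) ^ (2 * l))"
proof -
  let ?C = "copies (hypercube n) (cycle (2 * l))"
  have "card (flip_coord ` edges K) \<le> l" if K: "K \<in> ?C" for K
  proof -
    obtain g where "cycle_in (hypercube n) (2 * l) g" "K = cyc (2 * l) g"
      using K copies_cycle[OF simple_graph_hypercube, of "2 * l" n] l by auto
    then show ?thesis
      using card_flip_coord_le[of n "2 * l" g] by (simp add: flip_coord_edges_cyc)
  qed
  then have "?C = {K \<in> ?C. card (flip_coord ` edges K) = l} \<union> {K \<in> ?C. card (flip_coord ` edges K) \<le> l - 1}"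
    by fastforce
  then have "card ?C \<le> card {K \<in> ?C. card (flip_coord ` edges K) = l} + card {K \<in> ?C. card (flip_coord ` edges K) \<le> l - 1}"
    by (metis (no_types, lifting) card_Un_le)
  also have "\<dots> \<le> (n choose l) * 2 ^ (n - l) * z l l + 2 ^ n * (n ^ (l - 1) * (l - 1) ^ (2 * l))"
    using l n by (intro add_mono card_copies_l_coords card_copies_few_coords) auto
  finally show ?thesis
    by (simp add: num_copies_def)
qed

section \<open>The lower bound on the density\<close>

lemma copy_density_lower:
  assumes l: "4 \<le> l" "l \<le> n"
  shows "inverse (4 ^ (l + 1) * real (z l l) * (1 + 2 ^ l * real l ^ l * real (l - 1) ^ (2 * l) / real n))
    \<le> copy_density (hypercube n) (cycle (2 * l)) (cycle 6)"
proof (cases "z l l = 0")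
  case True
  \<comment> \<open>Since \<open>inverse 0 = 0\<close>, only nonnegativity of the density is
    claimed.\<close>
  then show ?thesis
    by (simp add: copy_density_def)
next
  case False
  define c where "c = real (l - 1) ^ (2 * l)"
  \<comment> \<open>The ratio of the error term \<open>2 ^ n * n ^ (l - 1) * c\<close> to
    \<open>(n / l) ^ l * 2 ^ (n - l)\<close>, a lower bound for \<open>A\<close>.\<close>
  define \<epsilon> where "\<epsilon> = 2 ^ l * real l ^ l * c / real n"
  define A where "A = real ((n choose l) * 2 ^ (n - l))"
  define N where "N = num_copies (hypercube n) (cycle (2 * l))"
  define X where "X = ex_copies (hypercube n) (cycle (2 * l)) (cycle 6)"
  have n0: "real n > 0" and l0: "real l > 0"
    using l by simp_all
  have \<epsilon>: "\<epsilon> \<ge> 0"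
    by (simp add: \<epsilon>_def c_def)
  have A0: "A > 0"
    using l by (simp add: A_def)
  have AX: "A \<le> real X * 4 ^ (l + 1)"
    using of_nat_mono[OF ex_copies_lower[OF l], where 'a = real] by (simp add: A_def X_def)
  have "2 ^ n * (real n ^ (l - 1) * c) = (real n / real l) ^ l * 2 ^ (n - l) * \<epsilon>"
  proof -
    have "(2::real) ^ n = 2 ^ (n - l) * 2 ^ l"
      using l by (simp flip: power_add)
    moreover have "real n ^ l = real n * real n ^ (l - 1)"
      using l by (simp flip: power_Suc)
    ultimately show ?thesis
      using n0 l0 by (simp add: \<epsilon>_def power_divide)
  qed
  also have "\<dots> \<le> A * \<epsilon>"
    using binomial_ge_n_over_k_pow_k[OF l(2), where 'a = real] \<epsilon>
    by (auto simp: A_def intro!: mult_right_mono)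
  \<comment> \<open>Here \<open>z l l\<close> is a nonzero natural number, so it is at least
    1.\<close>
  also have "\<dots> \<le> A * real (z l l) * \<epsilon>"
    using False A0 \<epsilon> by (intro mult_right_mono) auto
  finally have "2 ^ n * (real n ^ (l - 1) * c) \<le> A * real (z l l) * \<epsilon>" .
  moreover have "real N \<le> A * real (z l l) + 2 ^ n * (real n ^ (l - 1) * c)"
    using of_nat_mono[OF num_copies_hypercube_le[of l n], where 'a = real] l
    by (simp add: N_def A_def c_def)
  ultimately have NA: "real N \<le> A * (real (z l l) * (1 + \<epsilon>))"
    by (simp add: algebra_simps)
  have X0: "X > 0"
    using AX A0 by (cases "X = 0") auto
  \<comment> \<open>Needed for \<open>N > 0\<close>, without which the final quotient would be 0 by
    convention.\<close>
  have "X \<le> N"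
  proof -
    have "edges (cycle 6) \<noteq> {}"
      by (auto simp: cycle_def intro: exI[of _ 0])
    from ex_copies_in[OF simple_graph_hypercube this simple_graph_cycle, of n "cycle (2 * l)"]
    obtain G where G: "subgraph G (hypercube n)" "X = num_copies G (cycle (2 * l))"
      by (auto simp: X_def)
    have "copies G (cycle (2 * l)) \<subseteq> copies (hypercube n) (cycle (2 * l))"
      using G(1) by (auto simp: copies_def subgraph_def)
    then show ?thesis
      unfolding G(2) N_def num_copies_def by (intro card_mono finite_copies simple_graph_hypercube)
  qed
  then have N0: "real N > 0"
    using X0 by simp
  have "inverse (4 ^ (l + 1) * real (z l l) * (1 + \<epsilon>)) = (A / 4 ^ (l + 1)) / (A * (real (z l l) * (1 + \<epsilon>)))"
    using A0 by (simp add: inverse_eq_divide mult.left_commute[of _ A] mult.assoc del: distrib_left_numeral)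
  also have "\<dots> \<le> real X / real N"
    using NA AX N0 A0 by (intro frac_le) (auto simp: divide_le_eq)
  finally show ?thesis
    by (simp add: copy_density_def \<epsilon>_def c_def X_def N_def)
qed

theorem theorem3:
  fixes l :: nat
  assumes "l \<ge> 4"
  shows "\<exists>\<epsilon> :: nat \<Rightarrow> real.
           (\<forall>n. \<epsilon> n \<ge> 0) \<and> \<epsilon> \<longlonglongrightarrow> 0 \<and>
           (\<forall>\<^sub>F n in sequentially.
              inverse (4 ^ (l + 1) * real (z l l) * (1 + \<epsilon> n))
                \<le> copy_density (hypercube n) (cycle (2 * l)) (cycle 6) \<and>
              copy_density (hypercube n) (cycle (2 * l)) (cycle 6) \<le> 0.36577)"
proof (intro exI conjI allI)
  let ?\<epsilon> = "\<lambda>n. 2 ^ l * real l ^ l * real (l - 1) ^ (2 * l) / real n"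
  show "0 \<le> ?\<epsilon> n" for n
    by simp
  show "?\<epsilon> \<longlonglongrightarrow> 0"
    by (rule lim_const_over_n)
  show "\<forall>\<^sub>F n in sequentially.
      inverse (4 ^ (l + 1) * real (z l l) * (1 + ?\<epsilon> n))
        \<le> copy_density (hypercube n) (cycle (2 * l)) (cycle 6) \<and>
      copy_density (hypercube n) (cycle (2 * l)) (cycle 6) \<le> 0.36577"
    \<comment> \<open>62 serves the upper bound, \<open>l\<close> the lower one.\<close>
    using eventually_ge_at_top[of "max 62 l"]
  proof eventually_elim
    case (elim n)
    then show ?case
      using copy_density_lower[OF assms, of n] copy_density_upper[of "2 * l" n] assms by simp
  qed
qed

end
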